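(* For sets without proper arithmetic progressions of length $3$ the following exact values hold: $r_3(\mathbb{Z}_4^1)=2$, $r_3(\mathbb{Z}_4^2)=6$, $r_3(\mathbb{Z}_4^3)=16$, $r_3(\mathbb{Z}_4^4)=42$, and $r_3(\mathbb{Z}_4^5)=124$.
   Context: $\mathbb{Z}_m^n$ denotes the additive group $(\mathbb{Z}/m\mathbb{Z})^n$. A proper arithmetic progression of length $k$ in $\mathbb{Z}_m^n$ is a sequence $x, x+d, \ldots, x+(k-1)d$ (with $x,d\in\mathbb{Z}_m^n$) whose $k$ elements are pairwise distinct. $r_k(\mathbb{Z}_m^n)$ denotes the maximal size of a set $S\subseteq\mathbb{Z}_m^n$ that does not contain a proper arithmetic progression of length $k$. *)

theory Defs
  imports "HOL-Algebra.Product_Groups" "HOL-Algebra.Elementary_Groups"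
begin

text \<open>
  The library's groups are written multiplicatively: the additive expression
  \<open>x + i d\<close> is rendered as \<open>x \<otimes>\<^bsub>G\<^esub> d [^]\<^bsub>G\<^esub> i\<close>.
\<close>

definition Zmod_power :: "nat \<Rightarrow> nat \<Rightarrow> (nat \<Rightarrow> int) monoid" where
  "Zmod_power m n = product_group {..<n} (\<lambda>_. integer_mod_group m)"

definition proper_AP :: "('a, 'b) monoid_scheme \<Rightarrow> nat \<Rightarrow> 'a list \<Rightarrow> bool" where
  "proper_AP G k xs \<longleftrightarrow>
     (\<exists>x\<in>carrier G. \<exists>d\<in>carrier G. xs = map (\<lambda>i. x \<otimes>\<^bsub>G\<^esub> d [^]\<^bsub>G\<^esub> i) [0..<k]) \<and>
     distinct xs"

definition AP_free :: "('a, 'b) monoid_scheme \<Rightarrow> nat \<Rightarrow> 'a set \<Rightarrow> bool" where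
  "AP_free G k S \<longleftrightarrow> S \<subseteq> carrier G \<and> \<not> (\<exists>xs. proper_AP G k xs \<and> set xs \<subseteq> S)"

text \<open>
  The maximum is taken over a finite nonempty set whenever \<open>carrier G\<close> is finite and
  \<open>k \<ge> 1\<close>.  For \<open>G = Zmod_power m n\<close> this requires \<open>m \<ge> 1\<close> or \<open>n = 0\<close>, because
  \<open>integer_mod_group 0\<close> is the group of all integers.
\<close>

definition max_AP_free :: "nat \<Rightarrow> ('a, 'b) monoid_scheme \<Rightarrow> nat" where
  "max_AP_free k G = Max {card S | S. AP_free G k S}"

lemma finite_carrier_Zmod_power:
  assumes "m > 0"
  shows "finite (carrier (Zmod_power m n))"
  using assms by (auto simp: Zmod_power_def carrier_integer_mod_group intro!: finite_PiE)

end

theory Submission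
  imports Defs "HOL-Library.Z2" "HOL-Library.Function_Algebras"
begin

text \<open>
  Write \<open>x \<in> Z_4^n\<close> as \<open>r + 2u\<close> with bit vectors \<open>r\<close> and \<open>u\<close>. A set \<open>S\<close> becomes a relation
  \<open>R\<close> between bit vectors; let \<open>B\<close> be its domain and \<open>A r\<close> its fibers. Then \<open>S\<close> has no proper
  3-term progression iff no \<open>u + v\<close> with distinct \<open>u, v \<in> A r\<close> lies in \<open>r + B\<close>, and
  \<open>card S\<close> is the sum of the \<open>card (A r)\<close>.

  A fiber with at least 5 elements forces a 3-dimensional flat that meets \<open>B\<close> only in \<open>r\<close>, or else
  a 4-dimensional flat that meets \<open>B\<close> in six points of sum zero (a hexad). For \<open>n \<le> 4\<close> this and the
  fact that a fiber of size 3 writes \<open>r\<close> as a sum of three points outside \<open>B\<close> suffice. For \<open>n = 5\<close>,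
  fibers with more than 8 elements leave at most 11 points in \<open>B\<close> or a hyperplane
  that meets \<open>B\<close> in one point. If all fibers have at most 8 elements, only
  \<open>card B \<ge> 16\<close> is a problem. A hexad then leaves few triples for the other points of \<open>B\<close>.
  Without a hexad, let \<open>T\<close> be the set of \<open>r\<close> with a 3-dimensional flat as above. Any two of these
  flats meet in an even number of points, so by Oddtown \<open>T\<close> is at most as large as the complement of
  \<open>B\<close>, which gives 128. Equality would mean \<open>T = B\<close> and \<open>card B = 16\<close>, which is impossible,
  and so the bound improves to 124.
\<close>

section \<open>Elementary abelian 2-groups\<close>

text \<open>The thresholds come from counting. Any k + 2 points of a k-dimensional flat are affinely
  dependent, so fibers of size 6 in dimension 4 and of size 7 in dimension 5 always produce a
  3-dimensional flat; a fiber of size 5 can still be independent, and this is where the hexad comes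
  in. A fiber of size 9 in dimension 5 cannot coexist with three points r + x, r + y, r + x + y in
  B, since 4 * 9 > 32, so B is sum-free as seen from r. The end of the proof has no slack: in the
  extremal example of dimension 5, B has 16 points and T contains all of them except 0, so card B +
  card T = 31, and precisely the value 32 that Oddtown still allows has to be treated
  separately.\<close>

class boolean_group = ab_group_add +
  assumes add_self [simp]: "x + x = 0"
begin

lemma add_self_left [simp]: "x + (x + y) = y"
  by (simp add: add.assoc [symmetric])

lemma add_eq_0_iff_eq [simp]: "x + y = 0 \<longleftrightarrow> x = y"
  by (metis add_self_left add_0_right add_self)

lemma zero_eq_add_iff [simp]: "0 = x + y \<longleftrightarrow> x = y"
  by (metis add_eq_0_iff_eq)

lemma add_eq_iff: "x + y = z \<longleftrightarrow> y = x + z"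
  by auto

text \<open>The coset a + H, written as a preimage so that membership is a rewrite rule; it agrees
  with the image because a is its own inverse.\<close>

definition shift :: "'a \<Rightarrow> 'a set \<Rightarrow> 'a set" where
  "shift a H = {x. a + x \<in> H}"

lemma mem_shift [simp]: "x \<in> shift a H \<longleftrightarrow> a + x \<in> H"
  by (simp add: shift_def)

lemma shift_image: "shift a H = (+) a ` H"
  by (rule Set.set_eqI, simp add: image_iff) (metis add_self_left)

lemma card_shift [simp]: "card (shift a H) = card H"
  unfolding shift_image by (rule card_image) (simp add: inj_on_def)

lemma finite_shift [simp]: "finite (shift a H) \<longleftrightarrow> finite H"
  unfolding shift_image by (rule finite_image_iff) (simp add: inj_on_def)

text \<open>Finiteness is built in because the vector type used later is infinite; the cardinality,
  a power of two, then takes the place of the dimension. Inverses come for free from x + x =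
  0.\<close>

definition is_subgroup :: "'a set \<Rightarrow> bool" where
  "is_subgroup H \<longleftrightarrow> finite H \<and> 0 \<in> H \<and> (\<forall>x\<in>H. \<forall>y\<in>H. x + y \<in> H)"

lemma is_subgroupI: "finite H \<Longrightarrow> 0 \<in> H \<Longrightarrow> (\<And>x y. x \<in> H \<Longrightarrow> y \<in> H \<Longrightarrow> x + y \<in> H) \<Longrightarrow> is_subgroup H"
  by (auto simp: is_subgroup_def)

lemma is_subgroup_finite: "is_subgroup H \<Longrightarrow> finite H" and is_subgroup_0: "is_subgroup H \<Longrightarrow> 0 \<in> H"
  and is_subgroup_add: "is_subgroup H \<Longrightarrow> x \<in> H \<Longrightarrow> y \<in> H \<Longrightarrow> x + y \<in> H"
  by (auto simp: is_subgroup_def)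

lemma is_subgroup_add_cancel: "is_subgroup H \<Longrightarrow> x \<in> H \<Longrightarrow> x + y \<in> H \<longleftrightarrow> y \<in> H"
  by (metis is_subgroup_add add_self_left)

lemma is_subgroup_add_cancel': "is_subgroup H \<Longrightarrow> y \<in> H \<Longrightarrow> x + y \<in> H \<longleftrightarrow> x \<in> H"
  by (metis is_subgroup_add_cancel add.commute)

lemma shift_eq:
  assumes "is_subgroup H" "a + b \<in> H"
  shows "shift a H = shift b H"
proof (rule Set.set_eqI)
  fix x
  have "b + x = (a + b) + (a + x)"
    by (simp add: add_ac)
  then show "x \<in> shift a H \<longleftrightarrow> x \<in> shift b H"
    using assms by (metis mem_shift is_subgroup_add_cancel)
qed

lemma is_subgroup_extend:
  assumes "is_subgroup H" "x \<notin> H"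
  shows "is_subgroup (H \<union> shift x H)" "card (H \<union> shift x H) = 2 * card H"
proof -
  have H: "finite H" "0 \<in> H" using assms by (auto simp: is_subgroup_def)
  show "is_subgroup (H \<union> shift x H)"
  proof (rule is_subgroupI)
    fix u v assume "u \<in> H \<union> shift x H" "v \<in> H \<union> shift x H"
    then have uv: "u \<in> H \<or> x + u \<in> H" "v \<in> H \<or> x + v \<in> H" by auto
    have e: "u + v = (x + u) + (x + v)" "x + (u + v) = u + (x + v)" "x + (u + v) = (x + u) + v"
      by (simp_all add: add_ac)
    have "u + v \<in> H \<or> x + (u + v) \<in> H"
      using uv is_subgroup_add[OF assms(1)] by (metis e)
    then show "u + v \<in> H \<union> shift x H" by simp
  qed (use H in auto)
  have "H \<inter> shift x H = {}"
    using assms by (auto simp: is_subgroup_add_cancel')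
  then show "card (H \<union> shift x H) = 2 * card H"
    using H by (simp add: card_Un_disjoint)
qed

lemma is_subgroup_Int: "is_subgroup H \<Longrightarrow> is_subgroup K \<Longrightarrow> is_subgroup (H \<inter> K)"
  by (auto simp: is_subgroup_def)

text \<open>A maximal subgroup between H and G that avoids x has index 2: an element of G outside M
  and x + M could be adjoined to M without capturing x.\<close>

lemma is_subgroup_separate:
  assumes "is_subgroup G" "is_subgroup H" "H \<subseteq> G" "x \<in> G" "x \<notin> H"
  obtains M where "is_subgroup M" "H \<subseteq> M" "M \<subseteq> G" "x \<notin> M" "card G = 2 * card M"
proof -
  let ?S = "{M. is_subgroup M \<and> H \<subseteq> M \<and> M \<subseteq> G \<and> x \<notin> M}"
  have "finite ?S"
    by (rule finite_subset[of _ "Pow G"]) (use is_subgroup_finite[OF assms(1)] in auto)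
  moreover have "H \<in> ?S" using assms by auto
  ultimately obtain M where M: "M \<in> ?S" and max: "\<And>N. N \<in> ?S \<Longrightarrow> M \<subseteq> N \<Longrightarrow> N = M"
    by (metis (lifting) finite_has_maximal empty_iff)
  have G: "G = M \<union> shift x M"
  proof (rule equalityI; rule subsetI)
    fix y assume y: "y \<in> G"
    show "y \<in> M \<union> shift x M"
    proof (rule ccontr)
      assume n: "y \<notin> M \<union> shift x M"
      let ?N = "M \<union> shift y M"
      have "is_subgroup ?N" using is_subgroup_extend M n by auto
      moreover have "?N \<subseteq> G" using M y assms(1) by (auto simp: is_subgroup_add_cancel)
      moreover have "x \<notin> ?N" using M n by (simp add: add.commute)
      ultimately have "?N \<in> ?S" using M by blast
      with max have "?N = M" by blast
      moreover have "y \<in> ?N" using M by (auto simp: is_subgroup_0)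
      ultimately show False using n by auto
    qed
  next
    fix y assume "y \<in> M \<union> shift x M"
    then show "y \<in> G" using M assms by (auto simp: is_subgroup_add_cancel)
  qed
  then have "card G = 2 * card M" using is_subgroup_extend[of M x] M by auto
  then show ?thesis using that M by blast
qed

lemma index2:
  assumes "is_subgroup G" "is_subgroup M" "M \<subseteq> G" "card G = 2 * card M" "x \<in> G - M"
  shows "G = M \<union> shift x M"
proof -
  have "M \<union> shift x M \<subseteq> G"
    using assms by (auto simp: is_subgroup_add_cancel)
  then show ?thesis
    using assms is_subgroup_extend[of M x] is_subgroup_finite by (metis DiffD2 card_subset_eq)
qed

lemma index2_obtain:
  assumes "is_subgroup G" "is_subgroup M" "M \<subseteq> G" "card G = 2 * card M"
  obtains g where "g \<in> G" "g \<notin> M" "G = M \<union> shift g M" "M \<inter> shift g M = {}"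
proof -
  have "card M \<noteq> 0" using assms by (auto simp: is_subgroup_def)
  then have "G \<noteq> M" using assms by auto
  then obtain g where g: "g \<in> G - M" using assms by auto
  moreover have "M \<inter> shift g M = {}" using g assms by (auto simp: is_subgroup_add_cancel')
  ultimately show ?thesis using index2[OF assms] that by blast
qed

lemma index2_add:
  assumes "is_subgroup G" "is_subgroup M" "M \<subseteq> G" "card G = 2 * card M" "x \<in> G - M" "y \<in> G - M"
  shows "x + y \<in> M"
  using index2[OF assms(1-5)] assms(6) by auto

text \<open>All elements outside M represent the nonzero class of G / M. This parity count is the
  contradiction in \<open>clebsch\<close> and \<open>separated_zero_sum\<close>.\<close>

lemma index2_sum:
  assumes "is_subgroup G" "is_subgroup M" "M \<subseteq> G" "card G = 2 * card M" "finite Y" "Y \<subseteq> G - M"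
  shows "\<Sum>Y \<in> G" "\<Sum>Y \<in> M \<longleftrightarrow> even (card Y)"
proof -
  have "\<Sum>Y \<in> G \<and> (\<Sum>Y \<in> M \<longleftrightarrow> even (card Y))"
    using assms(5,6)
  proof (induction Y)
    case empty
    then show ?case using assms by (simp add: is_subgroup_0)
  next
    case (insert y Y)
    have "y \<in> G - M" using insert by auto
    moreover have "\<Sum>Y \<in> G" "\<Sum>Y \<in> M \<longleftrightarrow> even (card Y)" using insert by auto
    ultimately show ?case
      using insert.hyps assms index2_add[OF assms(1-4), of y "\<Sum>Y"]
      by (auto simp: is_subgroup_add is_subgroup_add_cancel')
  qed
  then show "\<Sum>Y \<in> G" "\<Sum>Y \<in> M \<longleftrightarrow> even (card Y)" by auto
qed

lemma index2_Int:
  assumes "is_subgroup G" "is_subgroup M" "M \<subseteq> G" "card G = 2 * card M" "is_subgroup H" "H \<subseteq> G" "\<not> H \<subseteq> M"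
  shows "card H = 2 * card (H \<inter> M)"
proof -
  obtain h where h: "h \<in> H" "h \<notin> M" using assms by auto
  have "H = (H \<inter> M) \<union> shift h (H \<inter> M)"
  proof (rule equalityI; rule subsetI)
    fix x assume x: "x \<in> H"
    show "x \<in> (H \<inter> M) \<union> shift h (H \<inter> M)"
      using index2_add[OF assms(1-4), of h x] x h assms by (auto simp: is_subgroup_add)
  next
    fix x assume "x \<in> (H \<inter> M) \<union> shift h (H \<inter> M)"
    then show "x \<in> H" using h assms(5) by (auto simp: is_subgroup_add_cancel)
  qed
  then show ?thesis
    using is_subgroup_extend[of "H \<inter> M" h] assms h by (metis IntD2 is_subgroup_Int)
qed

text \<open>The translates u + K for u in A are disjoint and lie in one coset of G. It bounds fibers
  through \<open>fiber_mult\<close>, and later sets that meet each coset of a plane at most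
  once.\<close>

lemma card_packing:
  assumes "is_subgroup G" "is_subgroup K" "K \<subseteq> G" "A \<subseteq> shift b G"
    and "\<And>u v. u \<in> A \<Longrightarrow> v \<in> A \<Longrightarrow> u \<noteq> v \<Longrightarrow> u + v \<notin> K"
  shows "card A * card K \<le> card G"
proof -
  have "inj_on (\<lambda>(u, k). u + k) (A \<times> K)"
  proof (rule inj_onI, clarify)
    fix u k v l assume *: "u \<in> A" "k \<in> K" "v \<in> A" "l \<in> K" "u + k = v + l"
    then have "u + v = k + l" by (metis add_self_left add.commute add.assoc)
    then have "u + v \<in> K" using * assms(2) by (simp add: is_subgroup_add)
    then have "u = v" using assms(5) * by blast
    then show "u = v \<and> k = l" using * by simp
  qed
  then have "card (A \<times> K) = card ((\<lambda>(u, k). u + k) ` (A \<times> K))" by (simp add: card_image)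
  also have "\<dots> \<le> card (shift b G)"
  proof (rule card_mono)
    show "(\<lambda>(u, k). u + k) ` (A \<times> K) \<subseteq> shift b G"
    proof clarify
      fix u k assume "u \<in> A" "k \<in> K"
      then have "b + u \<in> G" "k \<in> G" using assms by auto
      then have "(b + u) + k \<in> G" using assms(1) by (blast intro: is_subgroup_add)
      then show "u + k \<in> shift b G" by (simp add: add_ac)
    qed
  qed (use assms is_subgroup_finite in auto)
  finally show ?thesis by (simp add: card_cartesian_product)
qed

text \<open>An explicit list, so that membership splits into eight equations and the seven nonzero
  elements can be checked one by one.\<close>

definition span3 :: "'a \<Rightarrow> 'a \<Rightarrow> 'a \<Rightarrow> 'a set" where
  "span3 x y z = {0, x, y, x + y, z, x + z, y + z, x + (y + z)}"

lemma is_subgroup_span3: "is_subgroup (span3 x y z)"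
  by (rule is_subgroupI) (auto simp: span3_def add_ac)

lemma card_span3:
  assumes "x \<noteq> 0" "y \<noteq> 0" "y \<noteq> x" "z \<notin> {0, x, y, x + y}"
  shows "card (span3 x y z) = 8"
proof -
  have H: "is_subgroup {0, x, y, x + y}" by (rule is_subgroupI) (auto simp: add_ac)
  have "distinct [0, x, y, x + y]"
    using assms(1-3) by auto
  from distinct_card[OF this] have 4: "card {0, x, y, x + y} = 4" by simp
  have "span3 x y z = {0, x, y, x + y} \<union> shift z {0, x, y, x + y}"
  proof (rule Set.set_eqI)
    fix w
    have "w \<in> shift z {0, x, y, x + y} \<longleftrightarrow> w = z \<or> w = x + z \<or> w = y + z \<or> w = x + (y + z)"
      unfolding mem_shift insert_iff empty_iff add_eq_iff[of z] by (simp add: add_ac)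
    then show "w \<in> span3 x y z \<longleftrightarrow> w \<in> {0, x, y, x + y} \<union> shift z {0, x, y, x + y}"
      unfolding span3_def by blast
  qed
  then show ?thesis using is_subgroup_extend(2)[OF H assms(4)] 4 by simp
qed

section \<open>Zero sums and affine dependencies\<close>

lemma sum_sym_diff:
  assumes "finite A" "finite B"
  shows "sum f ((A - B) \<union> (B - A)) = sum f A + (sum f B :: 'a)"
proof -
  have "sum f A = sum f (A - B) + sum f (A \<inter> B)" 
    using assms by (metis sum.Int_Diff add_commute)
  moreover have "sum f B = sum f (B - A) + sum f (A \<inter> B)"
    using assms by (metis sum.Int_Diff add_commute Int_commute)
  moreover have "sum f ((A - B) \<union> (B - A)) = sum f (A - B) + sum f (B - A)"
    using assms by (intro sum.union_disjoint) auto
  ultimately show ?thesis by (simp add: add_ac)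
qed

lemma sum_translate:
  "finite D \<Longrightarrow> (\<Sum>y\<in>D. x + y) = (if even (card D) then \<Sum>D else x + \<Sum>D)"
  by (induction D rule: finite_induct) (auto simp: add_ac)

text \<open>Affine dependence over F_2: for k + 1 points besides a base point x, the 2^(k+1) sets of
  differences to x have only 2^k possible sums, and two equal sums give a relation by symmetric
  difference. Only k + 2 points of X are used, hence the bound on \<open>card Y\<close>.\<close>

lemma even_zero_sum:
  assumes "is_subgroup G" "card G = 2 ^ k" "finite X" "X \<subseteq> shift a G" "card X \<ge> k + 2"
  obtains Y where "Y \<subseteq> X" "Y \<noteq> {}" "even (card Y)" "\<Sum>Y = 0" "card Y \<le> k + 2"
proof -
  obtain X1 where X1: "X1 \<subseteq> X" "card X1 = k + 2"
    using assms(5) by (meson obtain_subset_with_card_n)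
  then have "X1 \<noteq> {}" by auto
  then obtain x where x: "x \<in> X1" by auto
  define X2 where "X2 = X1 - {x}"
  have fin: "finite X1" using X1 assms(3) finite_subset by auto
  have c2: "card X2 = k + 1" "finite X2" using x X1 fin by (auto simp: X2_def)
  let ?f = "\<lambda>Y. \<Sum>y\<in>Y. x + y"
  have fG: "?f Y \<in> G" if "Y \<subseteq> X2" for Y
  proof -
    have "finite Y" using that c2 finite_subset by auto
    then show ?thesis using that
    proof (induction Y)
      case empty
      then show ?case using assms(1) by (simp add: is_subgroup_0)
    next
      case (insert y Y)
      have "a + x \<in> G" "a + y \<in> G" using x X1 insert.prems assms(4) by (auto simp: X2_def)
      then have "(a + x) + (a + y) \<in> G" using assms(1) by (rule is_subgroup_add[rotated])
      then have "x + y \<in> G" by (simp add: add_ac)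
      then show ?case using insert assms(1) by (simp add: is_subgroup_add)
    qed
  qed
  have "\<not> inj_on ?f (Pow X2)"
  proof
    assume "inj_on ?f (Pow X2)"
    then have "card (Pow X2) \<le> card G"
      by (rule card_inj_on_le) (use fG assms is_subgroup_finite in auto)
    then show False using c2 assms(2) by (simp add: card_Pow)
  qed
  then obtain Y1 Y2 where Y: "Y1 \<subseteq> X2" "Y2 \<subseteq> X2" "Y1 \<noteq> Y2" "?f Y1 = ?f Y2"
    by (auto simp: inj_on_def)
  define D where "D = (Y1 - Y2) \<union> (Y2 - Y1)"
  have D: "D \<noteq> {}" "D \<subseteq> X2" using Y by (auto simp: D_def)
  then have fD: "finite D" using c2(2) finite_subset by blast
  have D0: "?f D = 0"
    using sum_sym_diff[of Y1 Y2 "\<lambda>y. x + y"] Y finite_subset[OF _ c2(2)] by (simp add: D_def)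
  show ?thesis
  \<comment> \<open>The sum of x + y over D is 0. If D is odd, one copy of x survives in it, so x
    itself joins the set; either way the size becomes even.\<close>
  proof (cases "even (card D)")
    case True
    then have "\<Sum>D = 0" using D0 sum_translate[OF fD] by simp
    moreover have "card D \<le> k + 2" using card_mono[OF c2(2) D(2)] c2 by auto
    ultimately show ?thesis using that[of D] D True X1 by (auto simp: X2_def)
  next
    case False
    have "x \<notin> D" using D by (auto simp: X2_def)
    then have "\<Sum>(insert x D) = 0" "even (card (insert x D))"
      using D0 sum_translate[OF fD] False fD by auto
    moreover have "card (insert x D) \<le> k + 2"
      using card_mono[OF c2(2) D(2)] c2 fD by (simp add: card_insert_if)
    ultimately show ?thesis using that[of "insert x D"] D x X1 by (auto simp: X2_def)
  qed
qed

definition difference_set :: "'a set \<Rightarrow> 'a set" where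
  "difference_set A = {u + v | u v. u \<in> A \<and> v \<in> A \<and> u \<noteq> v}"

lemma difference_set_add: "u \<in> A \<Longrightarrow> v \<in> A \<Longrightarrow> u \<noteq> v \<Longrightarrow> u + v \<in> difference_set A"
  by (auto simp: difference_set_def)

lemma difference_set_shift:
  assumes "is_subgroup G" "A \<subseteq> shift b G"
  shows "difference_set A \<subseteq> G"
proof
  fix x assume "x \<in> difference_set A"
  then obtain u v where uv: "u \<in> A" "v \<in> A" "x = u + v" by (auto simp: difference_set_def)
  then have "b + u \<in> G" "b + v \<in> G" using assms by auto
  then have "(b + u) + (b + v) \<in> G" using assms(1) by (blast intro: is_subgroup_add)
  then show "x \<in> G" using uv by (simp add: add_ac)
qed

lemma zero_sum_even_ge:
  assumes "\<Sum>Y = (0::'a)" "even (card Y)" "finite Y" "Y \<noteq> {}"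
  shows "card Y \<ge> 4"
proof (rule ccontr)
  assume "\<not> ?thesis"
  moreover have "card Y \<noteq> 0" "card Y \<noteq> 1" "card Y \<noteq> 3" using assms by auto
  ultimately have "card Y = 2" by linarith
  then obtain x y where "Y = {x, y}" "x \<noteq> y" by (auto simp: card_2_iff)
  then show False using assms by auto
qed

text \<open>A zero sum makes pair sums coincide, so few points supply all seven nonzero elements of
  H. Four such points form an affine plane; its three directions are completed by the differences to
  a fifth point of A. Of six such points, a, b, c, d have six differences, and a + b + c + d = e + f
  is the seventh.\<close>

lemma zero_sum_subgroup:
  assumes "Y \<subseteq> A" "finite A" "card A \<ge> 5" "card Y = 4 \<or> card Y = 6" "\<Sum>Y = 0"
  obtains H where "is_subgroup H" "card H = 8" "H - {0} \<subseteq> difference_set A"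
  using assms(4)
proof
  assume "card Y = 4"
  then obtain a b c d where Y: "Y = {a, b, c, d}"
    and ne: "a \<noteq> b" "a \<noteq> c" "a \<noteq> d" "b \<noteq> c" "b \<noteq> d" "c \<noteq> d"
    by (auto simp: card_Suc_eq numeral_eq_Suc)
  have "(a + (b + c)) + d = 0" using assms(5) ne by (simp add: Y add_ac)
  then have d: "d = a + (b + c)" by (simp only: add_eq_0_iff_eq)
  have "A \<noteq> Y" using \<open>card Y = 4\<close> assms(3) by auto
  then obtain e where e: "e \<in> A" "e \<notin> Y" using assms(1) by auto
  have abc: "a + e \<noteq> b + c"
  proof
    assume "a + e = b + c"
    then have "e = d" unfolding add_eq_iff d .
    then show False using e Y by auto
  qed
  let ?H = "span3 (a + b) (a + c) (a + e)"
  have A: "a \<in> A" "b \<in> A" "c \<in> A" "d \<in> A" using assms(1) Y by auto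
  have e': "e \<noteq> a" "e \<noteq> b" "e \<noteq> c" "e \<noteq> d" using e Y by auto
  have "card ?H = 8"
    by (rule card_span3) (use ne e' abc in \<open>simp_all add: add_ac\<close>)
  moreover have "?H - {0} \<subseteq> difference_set A"
  proof -
    have "a + b \<in> difference_set A" "a + c \<in> difference_set A" "b + c \<in> difference_set A" "a + e \<in> difference_set A"
      "b + e \<in> difference_set A" "c + e \<in> difference_set A" "d + e \<in> difference_set A"
      using A ne e e' by (auto intro!: difference_set_add)
    then show ?thesis by (auto simp: span3_def add_ac d)
  qed
  ultimately show ?thesis using that is_subgroup_span3 by blast
next
  assume "card Y = 6"
  moreover have "finite Y" using assms(1,2) finite_subset by blast
  ultimately obtain xs where "set xs = Y" "distinct xs" "length xs = 6"
    by (metis distinct_card finite_distinct_list)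
  then obtain a b c d e f where Y: "Y = {a, b, c, d, e, f}" and ne: "distinct [a, b, c, d, e, f]"
    by (auto simp: length_Suc_conv numeral_eq_Suc)
  have "(a + (b + (c + d))) + (e + f) = 0" using assms(5) ne by (simp add: Y add_ac)
  then have f: "a + (b + (c + d)) = e + f" by (simp only: add_eq_0_iff_eq)
  have d: "d \<noteq> a + (b + c)"
  proof
    assume "d = a + (b + c)"
    then have "a + (b + (c + d)) = 0" by (simp add: add_ac)
    then show False using f ne by simp
  qed
  have abc: "a + d \<noteq> b + c"
  proof
    assume "a + d = b + c"
    then show False using d unfolding add_eq_iff by simp
  qed
  let ?H = "span3 (a + b) (a + c) (a + d)"
  have A: "a \<in> A" "b \<in> A" "c \<in> A" "d \<in> A" "e \<in> A" "f \<in> A" using assms(1) Y by auto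
  have "card ?H = 8"
    by (rule card_span3) (use ne d abc in \<open>auto simp: add_ac\<close>)
  moreover have "?H - {0} \<subseteq> difference_set A"
  proof -
    have "a + b \<in> difference_set A" "a + c \<in> difference_set A" "b + c \<in> difference_set A" "a + d \<in> difference_set A"
      "b + d \<in> difference_set A" "c + d \<in> difference_set A" "e + f \<in> difference_set A"
      using A ne by (auto intro!: difference_set_add)
    then show ?thesis by (auto simp: span3_def add_ac f[symmetric])
  qed
  ultimately show ?thesis using that is_subgroup_span3 by blast
qed

lemma large_set_subgroup:
  assumes "is_subgroup G" "card G = 2 ^ k" "3 \<le> k" "k \<le> 5" "A \<subseteq> shift b G" "card A \<ge> k + 2"
  obtains H where "is_subgroup H" "card H = 8" "H \<subseteq> G" "H - {0} \<subseteq> difference_set A"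
proof -
  have fin: "finite A" by (rule finite_subset[OF assms(5)]) (use assms(1) is_subgroup_finite in auto)
  obtain Y where Y: "Y \<subseteq> A" "Y \<noteq> {}" "even (card Y)" "\<Sum>Y = 0" "card Y \<le> k + 2"
    by (rule even_zero_sum[OF assms(1,2) fin assms(5,6)])
  have "card Y \<ge> 4" using zero_sum_even_ge[OF Y(4,3) finite_subset[OF Y(1) fin] Y(2)] .
  moreover have "card Y \<noteq> 5" "card Y \<noteq> 7" using Y(3) by auto
  ultimately have c: "card Y = 4 \<or> card Y = 6" using Y(5) assms(4) by linarith
  show ?thesis
  proof (rule zero_sum_subgroup[OF Y(1) fin _ c Y(4)])
    fix H assume H: "is_subgroup H" "card H = 8" "H - {0} \<subseteq> difference_set A"
    have "x \<in> G" if "x \<in> H" for x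
      using that H(3) difference_set_shift[OF assms(1,5)] is_subgroup_0[OF assms(1)] by (cases "x = 0") auto
    then show ?thesis using that H by auto
  qed (use assms in auto)
qed


definition triple_sums :: "'a set \<Rightarrow> 'a set" where
  "triple_sums Z = {x + y + z | x y z. x \<in> Z \<and> y \<in> Z \<and> z \<in> Z \<and> x \<noteq> y \<and> x \<noteq> z \<and> y \<noteq> z}"

lemma card_triple_sums:
  assumes "finite Z"
  shows "finite (triple_sums Z)" "card (triple_sums Z) \<le> card Z choose 3"
proof -
  let ?S = "{T. T \<subseteq> Z \<and> card T = 3}"
  have fin: "finite ?S" using assms by (auto intro: finite_subset[of _ "Pow Z"])
  have sub: "triple_sums Z \<subseteq> sum (\<lambda>x. x) ` ?S"
  proof
    fix s assume "s \<in> triple_sums Z"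
    then obtain x y z where *: "s = x + y + z" "x \<in> Z" "y \<in> Z" "z \<in> Z" "x \<noteq> y" "x \<noteq> z" "y \<noteq> z"
      by (auto simp: triple_sums_def)
    then have "s = \<Sum>{x, y, z}" "{x, y, z} \<in> ?S" by (auto simp: add_ac)
    then show "s \<in> sum (\<lambda>x. x) ` ?S" by blast
  qed
  show "finite (triple_sums Z)" using sub fin finite_subset by blast
  have "card (triple_sums Z) \<le> card (sum (\<lambda>x. x) ` ?S)" using sub fin by (intro card_mono) auto
  also have "\<dots> \<le> card ?S" using fin by (rule card_image_le)
  also have "\<dots> = card Z choose 3" using n_subsets[OF assms] by simp
  finally show "card (triple_sums Z) \<le> card Z choose 3" .
qed

lemma sum_shift:
  assumes "finite D" "even (card D)"
  shows "\<Sum>(shift a D) = \<Sum>D"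
proof -
  have "\<Sum>(shift a D) = (\<Sum>y\<in>D. a + y)"
    unfolding shift_image by (rule sum.reindex_cong[of "\<lambda>y. a + y"]) (auto simp: inj_on_def)
  then show ?thesis using sum_translate[OF assms(1)] assms(2) by simp
qed

end

section \<open>Relations encoding progression-free sets\<close>

lemma sum_le_two_level:
  fixes f :: "'b \<Rightarrow> nat"
  assumes "finite B" "T \<subseteq> B" "\<And>r. r \<in> B - T \<Longrightarrow> f r \<le> l" "\<And>r. r \<in> T \<Longrightarrow> f r \<le> l + d"
  shows "sum f B \<le> l * card B + d * card T"
proof -
  have fT: "finite T" using assms finite_subset by auto
  have "sum f B = sum f T + sum f (B - T)"
    using assms(1,2) by (metis sum.subset_diff add.commute)
  also have "sum f T \<le> card T * (l + d)"
    using sum_bounded_above[of T f "l + d"] assms(4) by simp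
  also have "sum f (B - T) \<le> card (B - T) * l"
    using sum_bounded_above[of "B - T" f l] assms(3) by simp
  also have "card (B - T) = card B - card T" using card_Diff_subset[OF fT assms(2)] .
  also have "card T * (l + d) + (card B - card T) * l = l * card B + d * card T"
  proof -
    have "card T \<le> card B" using assms card_mono by blast
    then obtain e where "card B = card T + e" using le_Suc_ex by blast
    then show ?thesis by (simp add: algebra_simps)
  qed
  finally show ?thesis by simp
qed

text \<open>The ends of x, x + d, x + 2d share the parity r and their halves differ by the parity of
  d. The half of the middle term is arbitrary, so only membership of its parity in the domain
  matters.\<close>

definition fiberwise_AP_free :: "('a::boolean_group \<times> 'a) set \<Rightarrow> bool" where
  "fiberwise_AP_free R \<longleftrightarrow> (\<forall>r u v. (r, u) \<in> R \<longrightarrow> (r, v) \<in> R \<longrightarrow> u \<noteq> v \<longrightarrow> r + (u + v) \<notin> Domain R)"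

lemma fiberwise_AP_free_mono: "fiberwise_AP_free R \<Longrightarrow> S \<subseteq> R \<Longrightarrow> fiberwise_AP_free S"
  unfolding fiberwise_AP_free_def by (meson Domain_mono subset_iff)

text \<open>Both components may lie in cosets, so that restricting \<open>R\<close> to cosets of a smaller subgroup
  gives another instance.\<close>

locale config =
  fixes G :: "'a::boolean_group set" and a b :: 'a and R :: "('a \<times> 'a) set"
  assumes subgroup_G: "is_subgroup G" and R_sub: "R \<subseteq> shift a G \<times> shift b G" and fiberwise_AP_free: "fiberwise_AP_free R"
begin

abbreviation "B \<equiv> Domain R"
abbreviation "A r \<equiv> R `` {r}"

lemma finite_G: "finite G" using subgroup_G is_subgroup_finite by blast

lemma finite_R: "finite R"
  by (rule finite_subset[OF R_sub]) (simp add: finite_G)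

lemma B_sub: "B \<subseteq> shift a G" using R_sub by auto

lemma finite_B: "finite B" using finite_R by (rule finite_Domain)

lemma A_sub: "A r \<subseteq> shift b G" using R_sub by auto

lemma finite_A: "finite (A r)"
  by (rule finite_subset[OF A_sub]) (simp add: finite_G)

lemma card_B_le: "card B \<le> card G"
  using card_mono[OF _ B_sub] finite_G by simp

lemma difference_set_A_sub: "difference_set (A r) \<subseteq> G"
  using difference_set_shift[OF subgroup_G A_sub] .

lemma difference_set_A: "d \<in> difference_set (A r) \<Longrightarrow> r + d \<notin> B"
  using fiberwise_AP_free by (auto simp: fiberwise_AP_free_def difference_set_def)

lemma card_R: "card R = (\<Sum>r\<in>B. card (A r))"
proof -
  have "R = Sigma B A" by auto
  then have "card R = card (Sigma B A)" by simp
  also have "\<dots> = (\<Sum>r\<in>B. card (A r))" using finite_B finite_A by (intro card_SigmaI) auto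
  finally show ?thesis .
qed

lemma add_in_G: "r \<in> B \<Longrightarrow> s \<in> B \<Longrightarrow> r + s \<in> G"
  using subsetD[OF B_sub, of r] subsetD[OF B_sub, of s] is_subgroup_add[OF subgroup_G, of "a + r" "a + s"]
  by (simp add: add_ac)

lemma shift_B: "r \<in> B \<Longrightarrow> shift r G = shift a G"
  using shift_eq[OF subgroup_G, of a r] subsetD[OF B_sub, of r] by simp

text \<open>A punctured flat r + (K - {0}) inside B keeps all differences of \<open>A r\<close> out
  of K, so the translates of K by \<open>A r\<close> are a packing.\<close>

lemma fiber_mult:
  assumes "is_subgroup K" "K \<subseteq> G" "\<And>k. k \<in> K \<Longrightarrow> k \<noteq> 0 \<Longrightarrow> r + k \<in> B"
  shows "card (A r) * card K \<le> card G"
proof (rule card_packing[OF subgroup_G assms(1,2) A_sub])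
  fix u v assume uv: "u \<in> A r" "v \<in> A r" "u \<noteq> v"
  show "u + v \<notin> K"
    using difference_set_A[OF difference_set_add[OF uv]] assms(3)[of "u + v"] uv(3) by auto
qed

lemma fiber_half:
  assumes "r \<in> B" "s \<in> B" "r \<noteq> s"
  shows "card (A r) * 2 \<le> card G"
proof -
  have "is_subgroup {0, r + s}" by (rule is_subgroupI) auto
  moreover have "card {0, r + s} = 2" using assms by (auto simp: card_2_iff')
  moreover have "{0, r + s} \<subseteq> G" using add_in_G assms subgroup_G is_subgroup_0 by auto
  ultimately show ?thesis using fiber_mult[of "{0, r + s}" r] assms(2) by auto
qed

lemma card_le_full:
  assumes "B = shift a G"
  shows "card R \<le> card G"
proof -
  have "card (A r) \<le> 1" if "r \<in> B" for r
  proof -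
    have "card (A r) * card G \<le> card G"
      using fiber_mult[OF subgroup_G subset_refl, of r] shift_B[OF that] assms by (metis add_self_left mem_shift)
    moreover have "card G > 0" using finite_G subgroup_G is_subgroup_0 card_gt_0_iff by blast
    ultimately show ?thesis by simp
  qed
  then have "card R \<le> card B * 1" unfolding card_R using sum_bounded_above[of B "\<lambda>r. card (A r)" 1] by simp
  then show ?thesis using card_B_le by simp
qed

lemma card_le_single:
  assumes "card B \<le> 1"
  shows "card R \<le> card G"
proof -
  have "card (A r) \<le> card G" for r using card_mono[OF _ A_sub] finite_G by simp
  then have "card R \<le> card B * card G" unfolding card_R using sum_bounded_above[of B "\<lambda>r. card (A r)" "card G"] by simp
  also have "\<dots> \<le> 1 * card G" using assms by (rule mult_le_mono1)
  finally show ?thesis by simp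
qed

lemma B_two:
  assumes "\<not> card B \<le> 1" "r \<in> B"
  obtains s where "s \<in> B" "r \<noteq> s"
proof -
  have "B \<noteq> {r}" using assms by auto
  then show ?thesis using assms(2) that by blast
qed

lemma card_A_half: "\<not> card B \<le> 1 \<Longrightarrow> r \<in> B \<Longrightarrow> card (A r) * 2 \<le> card G"
  using B_two fiber_half by metis

lemma restrict:
  "is_subgroup W \<Longrightarrow> R' \<subseteq> R \<Longrightarrow> R' \<subseteq> shift a' W \<times> shift b' W \<Longrightarrow> config W a' b' R'"
  using fiberwise_AP_free fiberwise_AP_free_mono by (auto simp: config_def)

text \<open>The step to a smaller dimension: the first components already lie in one coset of M, and
  sorting the second components into the two cosets of M gives two instances over M.\<close>

lemma split_bound:
  assumes M: "is_subgroup M" "M \<subseteq> G" "card G = 2 * card M"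
    and bound: "\<And>a b R. config M a b R \<Longrightarrow> card R \<le> c"
    and R': "R' \<subseteq> R" "Domain R' \<subseteq> shift a' M"
  shows "card R' \<le> 2 * c"
proof -
  obtain g where g: "G = M \<union> shift g M"
    using index2_obtain[OF subgroup_G M] by metis
  let ?R0 = "{p\<in>R'. snd p \<in> shift b M}" and ?R1 = "{p\<in>R'. snd p \<in> shift (b + g) M}"
  have "R' \<subseteq> ?R0 \<union> ?R1"
  proof
    fix p assume p: "p \<in> R'"
    then have "b + snd p \<in> G" using R' R_sub by auto
    then show "p \<in> ?R0 \<union> ?R1" using p unfolding g by (auto simp: add_ac)
  qed
  moreover have "finite R'" using R' finite_R finite_subset by blast
  ultimately have "card R' \<le> card (?R0 \<union> ?R1)" by (intro card_mono) auto
  also have "\<dots> \<le> card ?R0 + card ?R1" by (rule card_Un_le)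
  also have "card ?R0 \<le> c"
    by (rule bound[of a' b], rule restrict[OF M(1)]) (use R' in auto)
  also have "card ?R1 \<le> c"
    by (rule bound[of a' "b + g"], rule restrict[OF M(1)]) (use R' in auto)
  finally show ?thesis by simp
qed

text \<open>Apart from the fiber over r, all of R lives over the other coset of M, where
  \<open>split_bound\<close> applies.\<close>

lemma isolated_bound:
  assumes M: "is_subgroup M" "M \<subseteq> G" "card G = 2 * card M"
    and bound: "\<And>a b R. config M a b R \<Longrightarrow> card R \<le> c"
    and r: "r \<in> B" "B \<inter> shift r M = {r}"
  shows "card R \<le> card (A r) + 2 * c"
proof -
  obtain g where g: "G = M \<union> shift g M"
    using index2_obtain[OF subgroup_G M] by metis
  let ?R = "{p\<in>R. fst p \<noteq> r}"
  have "R = {r} \<times> A r \<union> ?R" by auto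
  then have "card R \<le> card ({r} \<times> A r) + card ?R" by (metis card_Un_le)
  also have "card ({r} \<times> A r) = card (A r)" by (simp add: card_cartesian_product)
  also have "card ?R \<le> 2 * c"
  proof (rule split_bound[OF M bound])
    show "Domain ?R \<subseteq> shift (g + r) M"
    proof
      fix s assume "s \<in> Domain ?R"
      then have s: "s \<in> B" "s \<noteq> r" by auto
      then have "s \<notin> shift r M" using r(2) by blast
      then have "r + s \<notin> M" by simp
      moreover have "r + s \<in> G" using add_in_G s r by simp
      ultimately have "g + (r + s) \<in> M" unfolding g by auto
      then show "s \<in> shift (g + r) M" by (simp add: add_ac)
    qed
  qed auto
  finally show ?thesis by simp
qed

lemma subgroup_in_difference_set:
  assumes "r \<in> B" "is_subgroup H" "H - {0} \<subseteq> difference_set (A r)"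
  shows "H \<subseteq> G" "B \<inter> shift r H = {r}"
proof -
  show "H \<subseteq> G"
  proof
    fix x assume "x \<in> H"
    then show "x \<in> G"
      using assms(3) difference_set_A_sub[of r] is_subgroup_0[OF subgroup_G] by (cases "x = 0") auto
  qed
  have "s = r" if "s \<in> B" "r + s \<in> H" for s
  proof (rule ccontr)
    assume "s \<noteq> r"
    then have "r + s \<in> difference_set (A r)" using that assms(3) by auto
    then show False using difference_set_A[of "r + s" r] that by simp
  qed
  then have "B \<inter> shift r H \<subseteq> {r}" by (simp add: subset_iff)
  moreover have "r \<in> B \<inter> shift r H" using assms(1) is_subgroup_0[OF assms(2)] by simp
  ultimately show "B \<inter> shift r H = {r}" by blast
qed

lemma large_fiber_isolated:
  assumes "card G = 2 ^ k" "3 \<le> k" "k \<le> 5" "r \<in> B" "card (A r) \<ge> k + 2"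
  obtains H where "is_subgroup H" "card H = 8" "H \<subseteq> G" "B \<inter> shift r H = {r}" "H - {0} \<subseteq> difference_set (A r)"
proof -
  obtain H where H: "is_subgroup H" "card H = 8" "H \<subseteq> G" "H - {0} \<subseteq> difference_set (A r)"
    by (rule large_set_subgroup[OF subgroup_G assms(1-3) A_sub assms(5)])
  then show ?thesis using that subgroup_in_difference_set[OF assms(4) H(1,4)] by blast
qed

text \<open>Three elements u, v, w of the fiber give three points r + (u + v), r + (u + w), r + (v +
  w) outside B, and their sum is r because u, v, w cancel in pairs. If u, v, w share a coset of W,
  these points stay in r + W.\<close>

lemma fiber_triple:
  assumes "is_subgroup W" "X \<subseteq> A r" "X \<subseteq> shift c W" "card X \<ge> 3"
  shows "r \<in> triple_sums (shift r W - B)"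
proof -
  obtain X' where X': "X' \<subseteq> X" "card X' = 3" using assms(4) by (meson obtain_subset_with_card_n)
  then obtain u v w where X3: "X' = {u, v, w}" "u \<noteq> v" "u \<noteq> w" "v \<noteq> w"
    by (auto simp: card_3_iff)
  have "r + (x + y) \<in> shift r W - B" if "x \<in> X'" "y \<in> X'" "x \<noteq> y" for x y
  proof -
    have "x \<in> A r" "y \<in> A r" "c + x \<in> W" "c + y \<in> W" using that X' assms(2,3) by auto
    then have "r + (x + y) \<notin> B" "(c + x) + (c + y) \<in> W"
      using difference_set_A[OF difference_set_add[of x "A r" y]] that assms(1) is_subgroup_add by auto
    then show ?thesis by (simp add: add_ac)
  qed
  then have "r + (u + v) \<in> shift r W - B" "r + (u + w) \<in> shift r W - B" "r + (v + w) \<in> shift r W - B"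
    using X3 by auto
  moreover have "r = r + (u + v) + (r + (u + w)) + (r + (v + w))"
    by (simp add: add_ac)
  moreover have "r + (u + v) \<noteq> r + (u + w)" "r + (u + v) \<noteq> r + (v + w)" "r + (u + w) \<noteq> r + (v + w)"
    using X3 by (auto simp: add.commute[of u])
  ultimately show ?thesis unfolding triple_sums_def by blast
qed

lemma fiber_triple':
  assumes "r \<in> B" "card (A r) \<ge> 3"
  shows "r \<in> triple_sums (shift a G - B)"
  using fiber_triple[OF subgroup_G subset_refl A_sub assms(2)] shift_B[OF assms(1)] by simp

text \<open>Every fiber is charged 2, and a fiber of size 3 or 4 is charged 2 more; the latter sit
  over triple sums of the gaps of B.\<close>

lemma triple_bound:
  assumes "\<And>r. r \<in> B \<Longrightarrow> card (A r) \<le> 4"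
  shows "card R \<le> 2 * card B + 2 * ((card G - card B) choose 3)"
proof -
  let ?N = "{r\<in>B. card (A r) \<ge> 3}"
  have "card R \<le> 2 * card B + 2 * card ?N"
    unfolding card_R by (rule sum_le_two_level) (use finite_B assms in auto)
  also have "card ?N \<le> card (triple_sums (shift a G - B))"
    by (rule card_mono[OF card_triple_sums(1)]) (use fiber_triple' finite_G in auto)
  also have "\<dots> \<le> card (shift a G - B) choose 3"
    by (rule card_triple_sums(2)) (simp add: finite_G)
  also have "card (shift a G - B) = card G - card B"
    using card_Diff_subset[OF finite_B B_sub] by simp
  finally show ?thesis by simp
qed

end

section \<open>Isolated points and hexads\<close>

context boolean_group begin

lemma span3_subset:
  assumes "is_subgroup G" "x \<in> G" "y \<in> G" "z \<in> G"
  shows "span3 x y z \<subseteq> G"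
  using assms by (auto simp: span3_def is_subgroup_0 intro!: is_subgroup_add)

definition span4 :: "'a \<Rightarrow> 'a \<Rightarrow> 'a \<Rightarrow> 'a \<Rightarrow> 'a set" where
  "span4 x y z w = span3 x y z \<union> shift w (span3 x y z)"

lemma span4:
  assumes "x \<noteq> 0" "y \<noteq> 0" "y \<noteq> x" "z \<notin> {0, x, y, x + y}" "w \<notin> span3 x y z"
  shows "is_subgroup (span4 x y z w)" "card (span4 x y z w) = 16"
  using is_subgroup_extend[OF is_subgroup_span3 assms(5)] card_span3[OF assms(1-4)] by (auto simp: span4_def)

lemma mem_span4:
  "v \<in> span4 x y z w \<longleftrightarrow> v \<in> {0, x, y, x + y, z, x + z, y + z, x + (y + z),
     w, x + w, y + w, x + (y + w), z + w, x + (z + w), y + (z + w), x + (y + (z + w))}"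
proof -
  have "v \<in> shift w (span3 x y z) \<longleftrightarrow> v \<in> {w, x + w, y + w, x + (y + w), z + w, x + (z + w), y + (z + w), x + (y + (z + w))}"
    unfolding mem_shift span3_def insert_iff empty_iff add_eq_iff[of w] by (simp add: add_ac)
  then show ?thesis unfolding span4_def Un_iff span3_def by (simp only: insert_iff empty_iff disj_assoc simp_thms)
qed

lemma span4_subset:
  assumes "is_subgroup G" "x \<in> G" "y \<in> G" "z \<in> G" "w \<in> G"
  shows "span4 x y z w \<subseteq> G"
  using assms by (auto simp: mem_span4 is_subgroup_0 intro!: is_subgroup_add)

lemma neq_if_add: "x + y = z \<Longrightarrow> z \<noteq> 0 \<Longrightarrow> x \<noteq> y"
  by auto

end

context config begin

definition isolated :: "'a \<Rightarrow> bool" where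
  "isolated r \<longleftrightarrow> (\<exists>H. is_subgroup H \<and> H \<subseteq> G \<and> card H = 8 \<and> B \<inter> shift r H = {r})"

lemma isolatedI:
  assumes "r \<in> B" "u \<noteq> 0" "v \<noteq> 0" "v \<noteq> u" "w \<notin> {0, u, v, u + v}" "u \<in> G" "v \<in> G" "w \<in> G"
    and "r + u \<notin> B" "r + v \<notin> B" "r + (u + v) \<notin> B" "r + w \<notin> B" "r + (u + w) \<notin> B"
      "r + (v + w) \<notin> B" "r + (u + (v + w)) \<notin> B"
  shows "isolated r"
proof -
  have "s = r" if "s \<in> B" "r + s \<in> span3 u v w" for s
    using that(2) that(1) assms(9-15) unfolding span3_def insert_iff empty_iff add_eq_iff[of r]
    by auto
  then have "B \<inter> shift r (span3 u v w) \<subseteq> {r}" by (simp add: subset_iff)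
  moreover have "r \<in> B \<inter> shift r (span3 u v w)" using assms(1) is_subgroup_0[OF is_subgroup_span3] by simp
  ultimately have "B \<inter> shift r (span3 u v w) = {r}" by blast
  then show ?thesis
    unfolding isolated_def using is_subgroup_span3 card_span3[OF assms(2-5)] span3_subset[OF subgroup_G assms(6-8)] by blast
qed

text \<open>Let x1, ..., x4 be the differences from one fiber point to four others. They are
  independent, since four fiber points of sum 0 would isolate r. Adding to r one of them, or a sum
  of two, leads outside B. The span of three of them has just one further nonzero element, their
  sum; as r is not isolated, r plus that sum must be in B. The sum of all four is forced in the same
  way, and r itself is the sixth point.\<close>

lemma hexad:
  assumes r: "r \<in> B" and card: "card (A r) \<ge> 5" and niso: "\<not> isolated r"
  obtains W where "is_subgroup W" "W \<subseteq> G" "card W = 16" "card (B \<inter> shift r W) = 6" "\<Sum>(B \<inter> shift r W) = 0"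
proof -
  have no4: "p + q + s + t \<noteq> 0" if "p \<in> A r" "q \<in> A r" "s \<in> A r" "t \<in> A r" "distinct [p, q, s, t]" for p q s t
  proof
    assume z: "p + q + s + t = 0"
    have "{p, q, s, t} \<subseteq> A r" "card {p, q, s, t} = 4 \<or> card {p, q, s, t} = 6" "\<Sum>{p, q, s, t} = 0"
      using that z by (auto simp: add.assoc simp del: add_eq_0_iff_eq)
    then obtain H where H: "is_subgroup H" "card H = 8" "H - {0} \<subseteq> difference_set (A r)"
      using zero_sum_subgroup[of "{p, q, s, t}" "A r"] finite_A card by metis
    have "isolated r"
      unfolding isolated_def using H subgroup_in_difference_set[OF r H(1,3)] by blast
    then show False using niso by simp
  qed
  obtain X where "X \<subseteq> A r" "card X = 5" using card by (meson obtain_subset_with_card_n)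
  moreover then obtain xs where "set xs = X" "distinct xs" "length xs = 5"
    by (metis card.infinite distinct_card finite_distinct_list zero_neq_numeral)
  ultimately obtain p0 p1 p2 p3 p4 where p: "distinct [p0, p1, p2, p3, p4]"
    "p0 \<in> A r" "p1 \<in> A r" "p2 \<in> A r" "p3 \<in> A r" "p4 \<in> A r"
    by (auto simp: length_Suc_conv numeral_eq_Suc)
  define x1 x2 x3 x4 where x: "x1 = p0 + p1" "x2 = p0 + p2" "x3 = p0 + p3" "x4 = p0 + p4"
  have E: "x1 + x2 = p1 + p2" "x1 + x3 = p1 + p3" "x2 + x3 = p2 + p3" "x1 + x4 = p1 + p4" "x2 + x4 = p2 + p4" "x3 + x4 = p3 + p4"
    unfolding x by (simp_all add: add_ac)
  have D: "x1 \<in> difference_set (A r)" "x2 \<in> difference_set (A r)" "x3 \<in> difference_set (A r)" "x4 \<in> difference_set (A r)"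
    "x1 + x2 \<in> difference_set (A r)" "x1 + x3 \<in> difference_set (A r)" "x2 + x3 \<in> difference_set (A r)"
    "x1 + x4 \<in> difference_set (A r)" "x2 + x4 \<in> difference_set (A r)" "x3 + x4 \<in> difference_set (A r)"
    unfolding E unfolding x using p by (auto intro!: difference_set_add)
  note nB = D[THEN difference_set_A] and inG = D[THEN subsetD[OF difference_set_A_sub]]
  have nz2: "x1 \<noteq> 0" "x2 \<noteq> 0" "x3 \<noteq> 0" "x4 \<noteq> 0" "x1 + x2 \<noteq> 0" "x1 + x3 \<noteq> 0" "x2 + x3 \<noteq> 0"
    "x1 + x4 \<noteq> 0" "x2 + x4 \<noteq> 0" "x3 + x4 \<noteq> 0"
    using nB r by (metis add_0_right)+
  have F: "x1 + x2 + x3 = p0 + p1 + p2 + p3" "x1 + x2 + x4 = p0 + p1 + p2 + p4" "x1 + x3 + x4 = p0 + p1 + p3 + p4"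
    "x2 + x3 + x4 = p0 + p2 + p3 + p4" "x1 + x2 + x3 + x4 = p1 + p2 + p3 + p4"
    unfolding x by (simp_all add: add_ac)
  have nz4: "x1 + x2 + x3 \<noteq> 0" "x1 + x2 + x4 \<noteq> 0" "x1 + x3 + x4 \<noteq> 0" "x2 + x3 + x4 \<noteq> 0"
    "x1 + x2 + x3 + x4 \<noteq> 0"
    using no4[of p0 p1 p2 p3] no4[of p0 p1 p2 p4] no4[of p0 p1 p3 p4] no4[of p0 p2 p3 p4] no4[of p1 p2 p3 p4] p
    unfolding F(5) unfolding F(1-4) by (simp_all del: add_eq_0_iff_eq)
  have nz4': "x1 + (x2 + x3) \<noteq> 0" "x1 + (x2 + x4) \<noteq> 0" "x1 + (x3 + x4) \<noteq> 0" "x2 + (x3 + x4) \<noteq> 0"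
    "x1 + (x2 + (x3 + x4)) \<noteq> 0"
    using nz4 unfolding add.assoc .
  have ne: "x1 \<noteq> x2" "x1 \<noteq> x3" "x2 \<noteq> x3" "x1 \<noteq> x4" "x2 \<noteq> x4" "x3 \<noteq> x4"
    using nz2 by simp_all
  have ne4: "x1 + x2 \<noteq> x3" "x1 + x2 \<noteq> x4" "x1 + x3 \<noteq> x4" "x2 + x3 \<noteq> x4" "x1 + (x2 + x3) \<noteq> x4"
    using nz4 unfolding add_eq_0_iff_eq by (simp_all add: add.assoc)
  note ne = ne ne4
  have i3: "x4 \<notin> span3 x1 x2 x3" using nz2(4) ne by (auto simp: span3_def)
  let ?W = "span4 x1 x2 x3 x4"
  have W: "is_subgroup ?W" "card ?W = 16" by (rule span4; use nz2 ne i3 in auto)+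
  have WG: "?W \<subseteq> G" using span4_subset[OF subgroup_G] inG by blast
  have 123: "r + (x1 + (x2 + x3)) \<in> B" and 124: "r + (x1 + (x2 + x4)) \<in> B"
    and 134: "r + (x1 + (x3 + x4)) \<in> B" and 234: "r + (x2 + (x3 + x4)) \<in> B"
    using isolatedI[of r x1 x2 x3] isolatedI[of r x1 x2 x4] isolatedI[of r x1 x3 x4] isolatedI[of r x2 x3 x4]
      r niso nB inG nz2 ne by blast+
  have e: "(x1 + x2) + (x1 + x3) = x2 + x3" "(x1 + x2) + (x1 + x4) = x2 + x4" "(x1 + x3) + (x1 + x4) = x3 + x4"
    "(x1 + x2) + (x3 + x4) = x1 + (x2 + (x3 + x4))"
    by (simp_all add: add_ac)
  have "x1 + x4 \<noteq> x2 + x3"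
    by (rule neq_if_add[OF _ nz4'(5)]) (simp add: add_ac)
  \<comment> \<open>The span of x1 + x2, x1 + x3, x1 + x4 consists of the sums of evenly many xi;
    its nonzero elements other than the sum of all four are differences.\<close>
  then have "isolated r" if "r + (x1 + (x2 + (x3 + x4))) \<notin> B"
    using isolatedI[of r "x1 + x2" "x1 + x3" "x1 + x4"] that r nB inG nz2 ne unfolding e by auto
  then have 1234: "r + (x1 + (x2 + (x3 + x4))) \<in> B" using niso by blast
  define qs where "qs = [0, x1 + (x2 + x3), x1 + (x2 + x4), x1 + (x3 + x4), x2 + (x3 + x4), x1 + (x2 + (x3 + x4))]"
  have eq: "B \<inter> shift r ?W = shift r (set qs)"
  proof (rule Set.set_eqI)
    fix s
    show "s \<in> B \<inter> shift r ?W \<longleftrightarrow> s \<in> shift r (set qs)"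
      unfolding Int_iff mem_shift mem_span4 qs_def list.set insert_iff empty_iff add_eq_iff[of r]
      using r 123 124 134 234 1234 nB by auto
  qed
  have dist': "x1 + (x2 + x3) \<noteq> x1 + (x2 + x4)"
    "x1 + (x2 + x3) \<noteq> x1 + (x3 + x4)"
    "x1 + (x2 + x3) \<noteq> x2 + (x3 + x4)"
    "x1 + (x2 + x3) \<noteq> x1 + (x2 + (x3 + x4))"
    "x1 + (x2 + x4) \<noteq> x1 + (x3 + x4)"
    "x1 + (x2 + x4) \<noteq> x2 + (x3 + x4)"
    "x1 + (x2 + x4) \<noteq> x1 + (x2 + (x3 + x4))"
    "x1 + (x3 + x4) \<noteq> x2 + (x3 + x4)"
    "x1 + (x3 + x4) \<noteq> x1 + (x2 + (x3 + x4))"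
    "x2 + (x3 + x4) \<noteq> x1 + (x2 + (x3 + x4))"
    by ((rule neq_if_add[OF _ nz2(10)], simp add: add_ac),
      (rule neq_if_add[OF _ nz2(9)], simp add: add_ac),
      (rule neq_if_add[OF _ nz2(8)], simp add: add_ac),
      (rule neq_if_add[OF _ nz2(4)], simp add: add_ac),
      (rule neq_if_add[OF _ nz2(7)], simp add: add_ac),
      (rule neq_if_add[OF _ nz2(6)], simp add: add_ac),
      (rule neq_if_add[OF _ nz2(3)], simp add: add_ac),
      (rule neq_if_add[OF _ nz2(5)], simp add: add_ac),
      (rule neq_if_add[OF _ nz2(2)], simp add: add_ac),
      (rule neq_if_add[OF _ nz2(1)], simp add: add_ac))
  have dist: "distinct qs"
    unfolding qs_def distinct.simps list.set insert_iff empty_iff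
    by (simp only: nz4'[symmetric] dist' simp_thms)
  have "length qs = 6" by (simp add: qs_def)
  then have c6: "card (set qs) = 6" by (simp only: distinct_card[OF dist])
  have "\<Sum>(set qs) = sum_list qs" unfolding sum.distinct_set_conv_list[OF dist] by simp
  also have "\<dots> = 0" unfolding qs_def by (simp add: add_ac)
  finally have "\<Sum>(shift r (set qs)) = 0" using sum_shift[of "set qs" r] c6 by simp
  then show ?thesis using that[of ?W] W WG c6 unfolding eq by simp
qed

end

section \<open>Upper bounds in dimensions at most 4\<close>

lemma config_bound1: "config G a b R \<Longrightarrow> card G = 2 \<Longrightarrow> card R \<le> 2"
proof -
  assume "config G a b R" and c: "card G = 2"
  then interpret config G a b R by simp
  show ?thesis
  proof (cases "card B \<le> 1")
    case True
    then show ?thesis using card_le_single c by simp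
  next
    case False
    then have "card R \<le> card B * 1"
      unfolding card_R using sum_bounded_above[of B "\<lambda>r. card (A r)" 1] card_A_half c by simp
    then show ?thesis using card_B_le c by simp
  qed
qed

lemma config_bound2: "config G a b R \<Longrightarrow> card G = 4 \<Longrightarrow> card R \<le> 6"
proof -
  assume "config G a b R" and c: "card G = 4"
  then interpret config G a b R by simp
  consider "card B \<le> 1" | "\<not> card B \<le> 1" "card B \<le> 3" | "card B = 4"
    using card_B_le c by linarith
  then show ?thesis
  proof cases
    case 1
    then show ?thesis using card_le_single c by simp
  next
    case 2
    then have "card (A r) \<le> 2" if "r \<in> B" for r using card_A_half[OF 2(1) that] c by simp
    then have "card R \<le> card B * 2"
      unfolding card_R using sum_bounded_above[of B "\<lambda>r. card (A r)" 2] by simp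
    then show ?thesis using 2 by simp
  next
    case 3
    then have "B = shift a G" using card_subset_eq[OF _ B_sub] finite_G c by simp
    then show ?thesis using card_le_full c by simp
  qed
qed

text \<open>Four points with fibers of size at most 4 give 16. With more points of B, at most three
  gaps remain, hence at most one triple for \<open>triple_bound\<close>.\<close>

lemma config_bound3: "config G a b R \<Longrightarrow> card G = 8 \<Longrightarrow> card R \<le> 16"
proof -
  assume "config G a b R" and c: "card G = 8"
  then interpret config G a b R by simp
  show ?thesis
  proof (cases "card B \<le> 1")
    case True
    then show ?thesis using card_le_single c by simp
  next
    case False
    have A4: "card (A r) \<le> 4" if "r \<in> B" for r using card_A_half[OF False that] c by simp
    show ?thesis
    proof (cases "card B \<le> 4")
      case True
      have "card R \<le> card B * 4"
        unfolding card_R using sum_bounded_above[of B "\<lambda>r. card (A r)" 4] A4 by simp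
      then show ?thesis using True by simp
    next
      case False
      then have "card B \<in> {5, 6, 7, 8}" using card_B_le c by auto
      then show ?thesis using triple_bound[OF A4] c by (auto simp: binomial_eq_0)
    qed
  qed
qed

text \<open>An isolated point gives 8 + 2 * 16 = 40. A hexad fills the whole space, so B has six
  points with fibers of size at most 5. Otherwise fibers have size at most 4: ten points give 40,
  and from 11 points on \<open>triple_bound\<close> is largest at 11, with 22 + 2 * 10 = 42.\<close>

lemma config_bound4: "config G a b R \<Longrightarrow> card G = 16 \<Longrightarrow> card R \<le> 42"
proof -
  assume "config G a b R" and c: "card G = 16"
  then interpret config G a b R by simp
  show ?thesis
  proof (cases "\<exists>r\<in>B. isolated r")
    case True
    then obtain r H where r: "r \<in> B" "is_subgroup H" "H \<subseteq> G" "card H = 8" "B \<inter> shift r H = {r}"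
      unfolding isolated_def by blast
    show ?thesis
    proof (cases "card B \<le> 1")
      case True
      then show ?thesis using card_le_single c by simp
    next
      case False
      have "card R \<le> card (A r) + 2 * 16"
        by (rule isolated_bound[OF r(2,3) _ _ r(1,5)]) (use c r config_bound3 in auto)
      then show ?thesis using card_A_half[OF False r(1)] c by simp
    qed
  next
    case False
    have A5: "card (A r) \<le> 5" if r: "r \<in> B" for r
    proof (rule ccontr)
      assume "\<not> ?thesis"
      then have 6: "card (A r) \<ge> 4 + 2" by simp
      obtain H where "is_subgroup H" "card H = 8" "H \<subseteq> G" "B \<inter> shift r H = {r}"
        by (rule large_fiber_isolated[of 4 r]) (use c r 6 in simp_all)
      then show False using False r unfolding isolated_def by blast
    qed
    show ?thesis
    proof (cases "\<exists>r\<in>B. card (A r) \<ge> 5")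
      case True
      then obtain r where r: "r \<in> B" "card (A r) \<ge> 5" "\<not> isolated r" using False by blast
      obtain W where W: "is_subgroup W" "W \<subseteq> G" "card W = 16" "card (B \<inter> shift r W) = 6"
        by (rule hexad[OF r])
      have "W = G" using W card_subset_eq[OF finite_G] c by simp
      then have "B \<inter> shift r W = B" using shift_B[OF r(1)] B_sub by blast
      then have "card B = 6" using W by simp
      then show ?thesis
        unfolding card_R using sum_bounded_above[of B "\<lambda>r. card (A r)" 5] A5 by simp
    next
      case False
      have A4: "card (A r) \<le> 4" if "r \<in> B" for r
      proof -
        have "\<not> 5 \<le> card (A r)" using False that by blast
        then show ?thesis by simp
      qed
      show ?thesis
      proof (cases "card B \<le> 10")
        case True
        have "card R \<le> card B * 4"
          unfolding card_R using sum_bounded_above[of B "\<lambda>r. card (A r)" 4] A4 by simp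
        then show ?thesis using True by simp
      next
        case False
        then have "card B \<in> {11, 12, 13, 14, 15, 16}" using card_B_le c by auto
        moreover have "(5 choose 3) = (10::nat)" "(4 choose 3) = (4::nat)"
          by (simp_all add: numeral_eq_Suc)
        ultimately show ?thesis using triple_bound[OF A4] c by (auto simp: binomial_eq_0)
      qed
    qed
  qed
qed

section \<open>Sum-free sets, five-term circuits, and planes among six points\<close>

context boolean_group begin

lemma even_card_sym_diff:
  assumes "finite X" "finite Y"
  shows "even (card ((X - Y) \<union> (Y - X))) \<longleftrightarrow> (even (card X) \<longleftrightarrow> even (card Y))"
proof -
  have "card ((X - Y) \<union> (Y - X)) = card (X - Y) + card (Y - X)"
    using assms by (intro card_Un_disjoint) auto
  moreover have "card X = card (X - Y) + card (X \<inter> Y)" "card Y = card (Y - X) + card (X \<inter> Y)"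
    using assms card_Int_Diff[of X Y] card_Int_Diff[of Y X] by (simp_all add: Int_commute)
  ultimately show ?thesis by presburger
qed

lemma is_subgroup_even_sums:
  assumes "finite D"
  shows "is_subgroup {\<Sum>X | X. X \<subseteq> D \<and> even (card X)}" (is "is_subgroup ?E")
proof (rule is_subgroupI)
  have "?E \<subseteq> sum (\<lambda>x. x) ` Pow D" by auto
  then show "finite ?E" using assms finite_subset by blast
  show "0 \<in> ?E" by (rule CollectI, rule exI[of _ "{}"]) simp
next
  fix x y assume "x \<in> ?E" "y \<in> ?E"
  then obtain X Y where XY: "x = \<Sum>X" "X \<subseteq> D" "even (card X)" "y = \<Sum>Y" "Y \<subseteq> D" "even (card Y)" by blast
  have fin: "finite X" "finite Y" using XY assms finite_subset by blast+
  show "x + y \<in> ?E"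
    using XY sum_sym_diff[OF fin, of "\<lambda>x. x"] even_card_sym_diff[OF fin]
    by (intro CollectI exI[of _ "(X - Y) \<union> (Y - X)"]) auto
qed

text \<open>The alternative is that the Cayley graph with connection set \<open>D\<close> is bipartite or has a 5-cycle.\<close>

lemma hyperplane_or_circuit:
  assumes G: "is_subgroup G" "card G = 32" and D: "D \<subseteq> G" "0 \<notin> D"
    and sf: "\<And>x y. x \<in> D \<Longrightarrow> y \<in> D \<Longrightarrow> x \<noteq> y \<Longrightarrow> x + y \<notin> D"
  obtains M where "is_subgroup M" "M \<subseteq> G" "card G = 2 * card M" "M \<inter> D = {}"
  | Y where "Y \<subseteq> D" "card Y = 5" "\<Sum>Y = 0"
proof -
  have fin: "finite D" by (rule finite_subset[OF D(1)]) (use G is_subgroup_finite in auto)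
  \<comment> \<open>The elements reached from 0 by an even number of steps in D; repeated steps
    cancel.\<close>
  define E where "E = {\<Sum>X | X. X \<subseteq> D \<and> even (card X)}"
  have subgroup_E: "is_subgroup E" unfolding E_def by (rule is_subgroup_even_sums[OF fin])
  have EG: "E \<subseteq> G"
  proof
    fix x assume "x \<in> E"
    then obtain X where X: "x = \<Sum>X" "X \<subseteq> D" unfolding E_def by blast
    have "finite X" using X fin finite_subset by blast
    then have "X \<subseteq> G \<Longrightarrow> \<Sum>X \<in> G" by (induction X) (auto simp: is_subgroup_0[OF G(1)] is_subgroup_add[OF G(1)])
    then show "x \<in> G" using X D(1) by auto
  qed
  have pair: "x + y \<in> E" if "x \<in> D" "y \<in> D" for x y
  proof (cases "x = y")
    case True
    then show ?thesis using is_subgroup_0[OF subgroup_E] by simp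
  next
    case False
    then show ?thesis unfolding E_def using that by (intro CollectI exI[of _ "{x, y}"]) auto
  qed
  show ?thesis
  proof (cases "D \<subseteq> E \<and> D \<noteq> {}")
    case False
    \<comment> \<open>D lies in a single coset d + E, so an index-2 subgroup that contains E but not
      d misses D. For empty D any d outside E = {0} serves.\<close>
    have "\<exists>d\<in>G - E. D \<subseteq> shift d E"
    proof (cases "D = {}")
      case True
      then have "E = {0}" unfolding E_def by auto
      then have "G \<noteq> E" using G(2) by auto
      then show ?thesis using EG True by auto
    next
      case F: False
      then obtain d where d: "d \<in> D" "d \<notin> E" using False by blast
      then show ?thesis using pair D(1) by (intro bexI[of _ d]) auto
    qed
    then obtain d where d: "d \<in> G" "d \<notin> E" "D \<subseteq> shift d E" by blast
    obtain M where M: "is_subgroup M" "E \<subseteq> M" "M \<subseteq> G" "d \<notin> M" "card G = 2 * card M"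
      by (rule is_subgroup_separate[OF G(1) subgroup_E EG d(1,2)])
    have "x \<notin> M" if "x \<in> D" for x
    proof -
      have "x \<in> shift d E" using that d(3) by blast
      then have "d + x \<in> M" using M(2) by auto
      then show ?thesis using is_subgroup_add_cancel'[OF M(1), of x d] M(4) by auto
    qed
    then show ?thesis using that(1) M by blast
  next
    case True
    then obtain d where d: "d \<in> D" "d \<in> E" by auto
    then obtain X where X: "d = \<Sum>X" "X \<subseteq> D" "even (card X)" unfolding E_def by auto
    have finX: "finite X" using X fin finite_subset by blast
    define Odd where "Odd Y \<longleftrightarrow> Y \<subseteq> D \<and> odd (card Y) \<and> \<Sum>Y = 0" for Y
    \<comment> \<open>Toggling d turns an even set of sum d into an odd set of sum 0.\<close>
    have "Odd ((X - {d}) \<union> ({d} - X))"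
      using X d even_card_sym_diff[OF finX, of "{d}"] sum_sym_diff[OF finX, of "{d}" "\<lambda>x. x"]
      unfolding Odd_def by auto
    then obtain Y where Y: "Odd Y" and min: "\<And>Y'. Odd Y' \<Longrightarrow> card Y \<le> card Y'"
      using ex_has_least_nat[of Odd _ card] by blast
    have Y': "Y \<subseteq> D" "odd (card Y)" "\<Sum>Y = 0" using Y unfolding Odd_def by auto
    have finY: "finite Y" using Y'(1) fin finite_subset by blast
    \<comment> \<open>Seven points of a 5-dimensional space contain an even set of sum 0, and
      deleting it would leave a smaller odd one. Sizes 1 and 3 contradict
      \<open>0 \<notin> D\<close> and sum-freeness.\<close>
    have "card Y \<le> 5"
    proof (rule ccontr)
      assume "\<not> ?thesis"
      then have c: "card Y \<ge> 5 + 2" using Y'(2) by presburger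
      have G0: "Y \<subseteq> shift 0 G" using Y'(1) D(1) by auto
      have c32: "card G = 2 ^ 5" using G(2) by simp
      obtain X where X: "X \<subseteq> Y" "X \<noteq> {}" "even (card X)" "\<Sum>X = 0"
        by (rule even_zero_sum[OF G(1) c32 finY G0 c])
      have "finite X" using X finY finite_subset by blast
      have cX: "card (Y - X) = card Y - card X" "card X \<le> card Y" "card X > 0"
        using card_Diff_subset[OF \<open>finite X\<close> X(1)] card_mono[OF finY X(1)] X(2) \<open>finite X\<close>
        by (auto simp: card_gt_0_iff)
      have "\<Sum>(Y - X) + \<Sum>X = \<Sum>Y" using sum.subset_diff[OF X(1) finY, of "\<lambda>x. x"] by simp
      then have "\<Sum>(Y - X) = 0" using X(4) Y'(3) by simp
      moreover have "odd (card (Y - X))" using cX X(3) Y'(2) by simp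
      ultimately have "Odd (Y - X)" unfolding Odd_def using Y'(1) by blast
      then show False using min[of "Y - X"] cX by linarith
    qed
    moreover have "card Y \<noteq> 1"
      using Y' D(2) by (auto simp: card_1_singleton_iff)
    moreover have "card Y \<noteq> 3"
    proof
      assume "card Y = 3"
      then obtain x y z where xyz: "Y = {x, y, z}" "x \<noteq> y" "x \<noteq> z" "y \<noteq> z" by (auto simp: card_3_iff)
      then have "\<Sum>Y = x + (y + z)" by simp
      then have "(x + y) + z = 0" using Y'(3) by (simp only: add.assoc)
      then have "x + y = z" by (simp only: add_eq_0_iff_eq)
      then show False using sf[of x y] xyz Y'(1) by auto
    qed
    ultimately have "card Y = 5" using Y'(2) by presburger
    then show ?thesis using that(2) Y' by blast
  qed
qed

text \<open>The fifth vector is the sum of the other four, and these are independent: a relation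
  among them would contradict distinctness, \<open>0 \<notin> Y\<close> or sum-freeness.\<close>

lemma circuit_span:
  assumes "is_subgroup G" "Y \<subseteq> G" "card Y = 5" "\<Sum>Y = 0" "0 \<notin> Y"
    and sf: "\<And>x y. x \<in> Y \<Longrightarrow> y \<in> Y \<Longrightarrow> x \<noteq> y \<Longrightarrow> x + y \<notin> Y"
  obtains W where "is_subgroup W" "W \<subseteq> G" "card W = 16" "Y \<subseteq> W"
proof -
  have "finite Y" using assms(3) by (metis card.infinite zero_neq_numeral)
  then obtain xs where "set xs = Y" "distinct xs" "length xs = 5"
    using assms(3) by (metis distinct_card finite_distinct_list)
  then obtain x1 x2 x3 x4 x5 where Y: "Y = {x1, x2, x3, x4, x5}" and ne: "distinct [x1, x2, x3, x4, x5]"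
    by (auto simp: length_Suc_conv numeral_eq_Suc)
  have "\<Sum>Y = x1 + (x2 + (x3 + (x4 + x5)))" using ne by (simp add: Y)
  then have "(x1 + (x2 + (x3 + x4))) + x5 = 0" using assms(4) by (simp only: add.assoc)
  then have x5: "x5 = x1 + (x2 + (x3 + x4))" by (simp only: add_eq_0_iff_eq)
  have nz: "x1 \<noteq> 0" "x2 \<noteq> 0" "x3 \<noteq> 0" "x4 \<noteq> 0" "x5 \<noteq> 0" using assms(5) Y by auto
  have "x4 \<noteq> x1 + (x2 + x3)"
  proof
    assume "x4 = x1 + (x2 + x3)"
    then have "x5 = 0" unfolding x5 by (simp add: add_ac)
    then show False using nz by simp
  qed
  moreover have "x1 + x2 \<noteq> x3" "x1 + x2 \<noteq> x4" "x1 + x3 \<noteq> x4" "x2 + x3 \<noteq> x4"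
    using sf[of x1 x2] sf[of x1 x3] sf[of x2 x3] ne Y by auto
  ultimately have i: "x3 \<notin> {0, x1, x2, x1 + x2}" "x4 \<notin> span3 x1 x2 x3"
    using ne nz by (auto simp: span3_def)
  have x: "x1 \<in> G" "x2 \<in> G" "x3 \<in> G" "x4 \<in> G" using assms(2) Y by auto
  have "Y \<subseteq> span4 x1 x2 x3 x4" unfolding Y x5 by (auto simp: mem_span4)
  then show ?thesis
    using that[of "span4 x1 x2 x3 x4"] span4[of x1 x2 x3 x4] i span4_subset[OF assms(1) x] nz ne by auto
qed

text \<open>The Clebsch graph (folded 5-cube) has independence number at most 5.\<close>

lemma clebsch:
  assumes "is_subgroup W" "card W = 16" "Y \<subseteq> W" "0 \<notin> Y" "card Y = 5" "\<Sum>Y = 0"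
    and "X \<subseteq> shift c W" "difference_set X \<inter> Y = {}"
  shows "card X \<le> 5"
proof (rule ccontr)
  assume "\<not> ?thesis"
  then have c: "4 + 2 \<le> card X" by simp
  have c16: "card W = 2 ^ 4" using assms(2) by simp
  \<comment> \<open>Six points force an index-2 subgroup H of W whose nonzero elements are
    differences of X. Then Y lies outside H, where an odd number of elements cannot sum to
    0.\<close>
  obtain H where H: "is_subgroup H" "card H = 8" "H \<subseteq> W" "H - {0} \<subseteq> difference_set X"
    by (rule large_set_subgroup[OF assms(1) c16 _ _ assms(7) c]) auto
  have "Y \<subseteq> W - H" using H(4) assms(3,4,8) by auto
  moreover have "finite Y" using assms(5) by (metis card.infinite zero_neq_numeral)
  ultimately have "\<Sum>Y \<in> H \<longleftrightarrow> even (card Y)"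
    using index2_sum(2)[OF assms(1) H(1,3)] H(2) assms(2) by simp
  then show False using assms(5,6) is_subgroup_0[OF H(1)] by simp
qed

text \<open>Translate r to 0 and drop it: an odd number of elements outside H would have sum 0.
  Hence a flat that isolates a point of a hexad must leave the 4-dimensional flat of the
  hexad.\<close>

lemma separated_zero_sum:
  assumes "is_subgroup W" "is_subgroup H" "H \<subseteq> W" "card W = 2 * card H"
    and "finite Q" "Q \<subseteq> shift r W" "Q \<inter> shift r H = {r}" "even (card Q)" "\<Sum>Q = 0"
  shows False
proof -
  let ?Y = "shift r Q - {0}"
  have r: "r \<in> Q" using assms(7) by auto
  have "?Y \<subseteq> W - H"
  proof
    fix y assume y: "y \<in> ?Y"
    then have q: "r + y \<in> Q" "r + y \<noteq> r" by auto
    have "r + y \<notin> shift r H" using q assms(7) by blast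
    moreover have "r + y \<in> shift r W" using q assms(6) by blast
    ultimately show "y \<in> W - H" by simp
  qed
  moreover have fin: "finite ?Y" using assms(5) by simp
  moreover have "\<Sum>?Y = 0"
    using sum.remove[of "shift r Q" 0 "\<lambda>x. x"] r assms(5) sum_shift[OF assms(5,8)] assms(9) by simp
  moreover have "odd (card ?Y)"
  proof -
    have "card (shift r Q) = Suc (card ?Y)" using card.remove[of "shift r Q" 0] r assms(5) by simp
    then show ?thesis using assms(8) by auto
  qed
  ultimately show False
    using index2_sum(2)[OF assms(1-4), of ?Y] is_subgroup_0[OF assms(2)] by simp
qed

lemma shift_add_mem: "is_subgroup U \<Longrightarrow> x \<in> shift p U \<Longrightarrow> y \<in> shift p U \<Longrightarrow> x + y \<in> U"
  using is_subgroup_add[of U "p + x" "p + y"] by (simp add: add_ac)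

lemma shift_mem_add: "is_subgroup U \<Longrightarrow> x \<in> shift p U \<Longrightarrow> x + y \<in> U \<Longrightarrow> y \<in> shift p U"
  using is_subgroup_add[of U "p + x" "x + y"] by (simp add: add_ac)

text \<open>A triple inside the plane sums to a point of the plane. A new sum uses z and two plane
  points, which contribute only their difference, a nonzero element of U.\<close>

lemma triples_flat_point:
  assumes "is_subgroup U" "card U = 4" "Z = insert z (shift p U)"
  shows "card (triple_sums Z - Z) \<le> 3"
proof -
  have fU: "finite U" using assms(1) is_subgroup_finite by blast
  have "triple_sums Z - Z \<subseteq> shift z (U - {0})"
  proof
    fix s assume s: "s \<in> triple_sums Z - Z"
    then obtain x y w where xyw: "s = x + y + w" "x \<in> Z" "y \<in> Z" "w \<in> Z" "x \<noteq> y" "x \<noteq> w" "y \<noteq> w"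
      by (auto simp: triple_sums_def)
    have key: "s \<in> shift z (U - {0})"
      if "s = x + (y + w)" "w = z" "x \<in> Z" "y \<in> Z" "x \<noteq> y" "x \<noteq> w" "y \<noteq> w" for x y w
    proof -
      have "x \<in> shift p U" "y \<in> shift p U" using that(2-7) assms(3) by blast+
      then have "x + y \<in> U" by (rule shift_add_mem[OF assms(1)])
      moreover have "z + s = x + y" unfolding that(1,2) by (simp add: add_ac)
      ultimately show ?thesis using that(5) by simp
    qed
    have s': "s = y + (w + x)" "s = x + (w + y)" "s = x + (y + w)" by (simp_all add: xyw(1) add_ac)
    have "x = z \<or> y = z \<or> w = z"
    proof (rule ccontr)
      assume "\<not> ?thesis"
      then have "x \<in> shift p U" "y \<in> shift p U" "w \<in> shift p U" using xyw assms(3) by blast+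
      then have "s \<in> shift p U"
        using shift_mem_add[OF assms(1), of w p s] shift_add_mem[OF assms(1), of x p y] xyw(1)
        by (simp add: add_ac)
      then show False using s assms(3) by simp
    qed
    then show "s \<in> shift z (U - {0})"
      using key[OF s'(1) _ xyw(3,4)] key[OF s'(2) _ xyw(2,4)] key[OF s'(3) _ xyw(2,3)] xyw(5-7)
      by blast
  qed
  then have "card (triple_sums Z - Z) \<le> card (shift z (U - {0}))" using fU by (intro card_mono) auto
  also have "\<dots> = 3" using assms(1,2) is_subgroup_0 fU by simp
  finally show ?thesis .
qed

text \<open>As z1 + z2 is in U, a triple with both extra points sums into the plane. New sums use
  exactly one extra point, with three choices each; \<open>flat_unique\<close> assumes seven of
  them.\<close>

lemma triples_flat_two_points:
  assumes U: "is_subgroup U" "card U = 4" and Z: "Z = insert z1 (insert z2 (shift p U))" and z: "z1 + z2 \<in> U"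
  shows "card (triple_sums Z - Z) \<le> 6"
proof -
  have fU: "finite U" using U(1) is_subgroup_finite by blast
  have "triple_sums Z - Z \<subseteq> shift z1 (U - {0}) \<union> shift z2 (U - {0})"
  proof
    fix s assume s: "s \<in> triple_sums Z - Z"
    then obtain x y w where xyw: "s = x + y + w" "x \<in> Z" "y \<in> Z" "w \<in> Z" "x \<noteq> y" "x \<noteq> w" "y \<noteq> w"
      by (auto simp: triple_sums_def)
    have outside: "s \<noteq> x + u" if "x \<in> shift p U" "u \<in> U" for x u
    proof
      assume "s = x + u"
      then have "s \<in> shift p U" using shift_mem_add[OF U(1) that(1), of s] that(2) by simp
      then show False using s Z by simp
    qed
    have zz: "y + w \<in> U" if "y \<in> {z1, z2}" "w \<in> {z1, z2}" "y \<noteq> w" for y w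
      using that z by (auto simp: add.commute)
    have key: "s \<in> shift z1 (U - {0}) \<union> shift z2 (U - {0})"
      if "s = x + (y + w)" "w \<in> {z1, z2}" "x \<in> Z" "y \<in> Z" "x \<noteq> y" "x \<noteq> w" "y \<noteq> w" for x y w
    proof -
      have "s = y + (x + w)" unfolding that(1) by (simp add: add_ac)
      then have "x \<in> {z1, z2} \<Longrightarrow> y \<notin> shift p U" using outside[of y "x + w"] zz[of x w] that(2,6) by blast
      moreover have "y \<in> {z1, z2} \<Longrightarrow> x \<notin> shift p U" using outside[of x "y + w"] zz[of y w] that(1,2,7) by blast
      ultimately have "x \<in> shift p U" "y \<in> shift p U" using that(2-7) Z by blast+
      then have "x + y \<in> U" by (rule shift_add_mem[OF U(1)])
      moreover have "w + s = x + y" unfolding that(1) by (simp add: add_ac)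
      ultimately have "s \<in> shift w (U - {0})" using that(5) by simp
      then show ?thesis using that(2) by blast
    qed
    have s': "s = y + (w + x)" "s = x + (w + y)" "s = x + (y + w)" by (simp_all add: xyw(1) add_ac)
    have "x \<in> {z1, z2} \<or> y \<in> {z1, z2} \<or> w \<in> {z1, z2}"
    proof (rule ccontr)
      assume "\<not> ?thesis"
      then have "x \<in> shift p U" "y \<in> shift p U" "w \<in> shift p U" using xyw Z by blast+
      then show False using outside[OF _ shift_add_mem[OF U(1)], of x y p w] s'(3) by blast
    qed
    then show "s \<in> shift z1 (U - {0}) \<union> shift z2 (U - {0})"
      using key[OF s'(1) _ xyw(3,4)] key[OF s'(2) _ xyw(2,4)] key[OF s'(3) _ xyw(2,3)] xyw(5-7)
      by blast
  qed
  then have "card (triple_sums Z - Z) \<le> card (shift z1 (U - {0}) \<union> shift z2 (U - {0}))"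
    using fU by (intro card_mono) auto
  also have "\<dots> \<le> card (shift z1 (U - {0})) + card (shift z2 (U - {0}))" by (rule card_Un_le)
  also have "\<dots> = 6" using U is_subgroup_0 fU by simp
  finally show ?thesis .
qed

text \<open>A second plane in Z either shares three points with the first, which fix its direction,
  or contains both points z1, z2 left over by the first. In the latter case z1 + z2 would be a
  direction of the first plane, which allows only six new sums.\<close>

lemma flat_unique:
  assumes U: "is_subgroup U" "card U = 4" "shift p U \<subseteq> Z" and U': "is_subgroup U'" "card U' = 4" "shift p' U' \<subseteq> Z"
    and Z: "card Z = 6" and t: "card (triple_sums Z - Z) \<ge> 7"
  shows "U' = U"
proof -
  have finZ: "finite Z" using Z by (metis card.infinite zero_neq_numeral)
  have "card (Z - shift p U) = 2"
    using card_Diff_subset[OF _ U(3)] is_subgroup_finite[OF U(1)] U(2) Z by simp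
  then obtain z1 z2 where z: "Z - shift p U = {z1, z2}" "z1 \<noteq> z2" by (auto simp: card_2_iff)
  have Ze: "Z = insert z1 (insert z2 (shift p U))"
  proof (rule Set.set_eqI)
    fix x
    have "x \<in> Z - shift p U \<longleftrightarrow> x \<in> {z1, z2}" by (simp only: z(1))
    moreover have "x \<in> shift p U \<Longrightarrow> x \<in> Z" by (rule subsetD[OF U(3)])
    ultimately show "x \<in> Z \<longleftrightarrow> x \<in> insert z1 (insert z2 (shift p U))" by blast
  qed
  have inP: "x \<in> shift p U" if "x \<in> shift p' U'" "x \<notin> {z1, z2}" for x
  proof -
    have "x \<in> Z" by (rule subsetD[OF U'(3) that(1)])
    then show ?thesis using that(2) unfolding Ze by blast
  qed
  have zU: "z1 + z2 \<notin> U" using triples_flat_two_points[OF U(1,2) Ze] t by auto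
  have step: "U' = U" if c3: "card (shift p U \<inter> shift p' U') \<ge> 3"
  proof -
    obtain X where "X \<subseteq> shift p U \<inter> shift p' U'" "card X = 3" using c3 by (meson obtain_subset_with_card_n)
    then obtain x y w where x: "x \<in> shift p U" "y \<in> shift p U" "w \<in> shift p U"
      "x \<in> shift p' U'" "y \<in> shift p' U'" "w \<in> shift p' U'" and ne: "x \<noteq> y" "x \<noteq> w" "y \<noteq> w"
      by (auto simp: card_3_iff)
    have "{0, x + y, x + w, y + w} \<subseteq> V \<and> card {0, x + y, x + w, y + w} = 4"
      if V: "is_subgroup V" "x \<in> shift q V" "y \<in> shift q V" "w \<in> shift q V" for V q
    proof
      show "{0, x + y, x + w, y + w} \<subseteq> V" using shift_add_mem[OF V(1,2,3)] shift_add_mem[OF V(1,2,4)] shift_add_mem[OF V(1,3,4)] is_subgroup_0[OF V(1)]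
        by simp
      have "x + w \<noteq> y + w" using ne by simp
      moreover have "x + y \<noteq> y + w"
        by (rule neq_if_add[of _ _ "x + w"]) (use ne in \<open>simp_all add: add_ac\<close>)
      ultimately have "distinct [0, x + y, x + w, y + w]" using ne by simp
      from distinct_card[OF this] show "card {0, x + y, x + w, y + w} = 4" by simp
    qed
    note 4 = this[OF U(1) x(1-3)] this[OF U'(1) x(4-6)]
    have "{0, x + y, x + w, y + w} = U"
      by (rule card_subset_eq[OF is_subgroup_finite[OF U(1)]]) (use 4 U(2) in auto)
    moreover have "{0, x + y, x + w, y + w} = U'"
      by (rule card_subset_eq[OF is_subgroup_finite[OF U'(1)]]) (use 4 U'(2) in auto)
    ultimately show ?thesis by simp
  qed
  show ?thesis
  proof (cases "z1 \<in> shift p' U' \<and> z2 \<in> shift p' U'")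
    case True
    have f': "finite (shift p' U')" using U'(1) is_subgroup_finite by simp
    have "card (shift p' U' - {z1, z2}) = 2" using True z(2) U'(2) f' by (simp add: card_Diff_subset)
    then obtain x y where xy: "shift p' U' - {z1, z2} = {x, y}" "x \<noteq> y" by (auto simp: card_2_iff)
    then have xy': "x \<in> shift p' U'" "y \<in> shift p' U'" "x \<notin> {z1, z2}" "y \<notin> {z1, z2}" by blast+
    have P: "x \<in> shift p U" "y \<in> shift p U" using inP xy' by blast+
    \<comment> \<open>The fourth point of the plane through x, z1 and z2. It must be y, and both x
      and y lie in the first plane.\<close>
    let ?v = "x + (z1 + z2)"
    have "?v \<in> shift p' U'"
      using shift_mem_add[OF U'(1) xy'(1), of ?v] shift_add_mem[OF U'(1), of z1 p' z2] True by simp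
    moreover have "?v \<noteq> x" using z(2) by simp
    moreover have "?v \<noteq> z1"
      by (rule neq_if_add[of _ _ "x + z2"]) (use xy'(3) in \<open>simp_all add: add_ac\<close>)
    moreover have "?v \<noteq> z2"
      by (rule neq_if_add[of _ _ "x + z1"]) (use xy'(3) in \<open>simp_all add: add_ac\<close>)
    ultimately have "?v = y" using xy(1) by blast
    then have "z1 + z2 = x + y" by auto
    then show ?thesis using shift_add_mem[OF U(1) P] zU by simp
  next
    case False
    have s: "shift p' U' - {z1, z2} \<subseteq> shift p U \<inter> shift p' U'" using inP by blast
    have "shift p' U' \<inter> {z1, z2} \<subseteq> {z1} \<or> shift p' U' \<inter> {z1, z2} \<subseteq> {z2}" using False by blast
    then have "card (shift p' U' \<inter> {z1, z2}) \<le> 1"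
      using card_mono[of "{z1}" "shift p' U' \<inter> {z1, z2}"] card_mono[of "{z2}" "shift p' U' \<inter> {z1, z2}"] by auto
    then have "card (shift p' U' - {z1, z2}) \<ge> 3"
      using card_Diff_subset_Int[of "shift p' U'" "{z1, z2}"] U'(2) by simp
    moreover have "finite (shift p U)" using is_subgroup_finite[OF U(1)] by simp
    then have "card (shift p' U' - {z1, z2}) \<le> card (shift p U \<inter> shift p' U')"
      using s by (intro card_mono) auto
    ultimately show ?thesis using step by linarith
  qed
qed

end

lemma card_le_two_parts:
  assumes "X \<subseteq> P \<union> Q"
  shows "card X \<le> card (X \<inter> P) + card (X \<inter> Q)"
proof -
  have "(X \<inter> P) \<union> (X \<inter> Q) = X" using assms by blast
  then show ?thesis using card_Un_le[of "X \<inter> P" "X \<inter> Q"] by simp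
qed

lemma eq_insert_if_Diff: "P \<subseteq> Z \<Longrightarrow> Z - P = {z} \<Longrightarrow> Z = insert z P"
  by blast

lemma Int_singletonD: "A \<inter> X = {s} \<Longrightarrow> t \<in> A \<Longrightarrow> t \<in> X \<Longrightarrow> t = s"
  by blast

section \<open>Splitting along a hyperplane\<close>

context config begin

text \<open>W cuts the isolating flat r + H into two planes of direction H \<inter> W: the one
  through r meets B only there, and the one in the opposite coset of W misses B altogether.\<close>

lemma isolated_split:
  assumes W: "is_subgroup W" "W \<subseteq> G" "card G = 2 * card W" and r: "r \<in> B"
    and H: "is_subgroup H" "H \<subseteq> G" "card H = 8" "B \<inter> shift r H = {r}" "\<not> H \<subseteq> W"
  obtains U p where "is_subgroup U" "U \<subseteq> W" "card U = 4" "shift p U \<subseteq> shift a G - shift r W - B" "B \<inter> shift r U = {r}"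
proof -
  let ?U = "H \<inter> W"
  obtain h where h: "h \<in> H" "h \<notin> W" using H(5) by blast
  have U: "is_subgroup ?U" "?U \<subseteq> W" "card ?U = 4"
    using is_subgroup_Int[OF H(1) W(1)] index2_Int[OF subgroup_G W H(1,2,5)] H(3) by auto
  have "shift (r + h) ?U \<subseteq> shift a G - shift r W - B"
  proof
    fix x assume "x \<in> shift (r + h) ?U"
    then have x: "h + (r + x) \<in> H" "h + (r + x) \<in> W" by (simp_all add: add_ac)
    have xH: "r + x \<in> H" using is_subgroup_add_cancel[OF H(1) h(1)] x(1) by simp
    have xW: "r + x \<notin> W" using is_subgroup_add_cancel'[OF W(1), of "r + x" h] x(2) h(2) by blast
    have "x \<in> shift r H" "x \<noteq> r" using xH xW is_subgroup_0[OF W(1)] by auto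
    then have "x \<notin> B" using H(4) by blast
    moreover have "x \<in> shift r G" using xH H(2) by auto
    ultimately show "x \<in> shift a G - shift r W - B" using xW shift_B[OF r] by auto
  qed
  moreover have "B \<inter> shift r ?U = {r}"
  proof -
    have "r \<in> shift r ?U" using is_subgroup_0[OF U(1)] by simp
    moreover have "shift r ?U \<subseteq> shift r H" by (simp add: subset_iff)
    ultimately show ?thesis using H(4) r by blast
  qed
  ultimately show ?thesis using that U by blast
qed

text \<open>Bookkeeping shared by \<open>hexad_bound\<close> and \<open>not_all_isolated\<close>: Q
  is the part of B in the coset of r, and Z are the gaps of B in the opposite coset.\<close>

lemma other_coset:
  assumes W: "is_subgroup W" "W \<subseteq> G" "card G = 2 * card W" and r: "r \<in> B"
    and Q: "Q = B \<inter> shift r W" and Z: "Z = shift a G - shift r W - B"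
  shows "card Z + (card B - card Q) = card W" "finite Z" "card Q \<le> card B"
    and "\<And>s. s \<in> B - Q \<Longrightarrow> shift a G - shift r W = shift s W"
proof -
  obtain g where g: "g \<in> G" "g \<notin> W" "G = W \<union> shift g W" "W \<inter> shift g W = {}"
    using index2_obtain[OF subgroup_G W] by metis
  have rG: "shift r G = shift a G" using shift_B[OF r] .
  have o: "shift a G - shift r W = shift (r + g) W"
    unfolding rG[symmetric] using g(4) by (subst g(3)) (auto simp: add_ac)
  show fZ: "finite Z" unfolding Z using finite_G by simp
  show "card Q \<le> card B" unfolding Q using finite_B by (intro card_mono) auto
  have CQ: "card B - card Q = card (B - Q)"
    unfolding Q using finite_B by (subst card_Diff_subset) auto
  have "shift a G - shift r W = Z \<union> (B - Q)" unfolding Z Q using B_sub by blast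
  moreover have "Z \<inter> (B - Q) = {}" unfolding Z by blast
  ultimately have "card Z + card (B - Q) = card (shift a G - shift r W)"
    using card_Un_disjoint[OF fZ, of "B - Q"] finite_B by simp
  then show "card Z + (card B - card Q) = card W" unfolding o CQ by simp
  fix s assume "s \<in> B - Q"
  then have "s \<in> shift a G - shift r W" using B_sub unfolding Q by blast
  then have "(r + g) + s \<in> W" unfolding o by simp
  then show "shift a G - shift r W = shift s W" unfolding o by (rule shift_eq[OF W(1)])
qed

end

section \<open>The upper bound in dimension 5\<close>

locale config5 = config +
  assumes card_G: "card G = 32"
begin

lemma fiber_le_16: "\<not> card B \<le> 1 \<Longrightarrow> r \<in> B \<Longrightarrow> card (A r) \<le> 16"
  using card_A_half[of r] card_G by simp

text \<open>The fiber over r and the opposite coset give at most 16 + 2 * 42 = 100; a single point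
  in B gives at most 32.\<close>

lemma isolated_hyperplane_bound:
  assumes M: "is_subgroup M" "M \<subseteq> G" "card G = 2 * card M" and r: "r \<in> B" "B \<inter> shift r M = {r}"
  shows "card R \<le> 124"
proof (cases "card B \<le> 1")
  case True
  then show ?thesis using card_le_single card_G by simp
next
  case False
  have "card R \<le> card (A r) + 2 * 42"
    by (rule isolated_bound[OF M _ r]) (use M card_G config_bound4 in auto)
  then show ?thesis using fiber_le_16[OF False r(1)] by simp
qed

text \<open>By \<open>fiber_mult\<close> and 9 * 4 > 32, the set D is sum-free. As no hyperplane
  separates r from the rest of B, D contains a five-term circuit Y. Differences of
  \<open>A r\<close> avoid Y because r + Y lies in B, and differences of D avoid it by sum-freeness;
  so \<open>clebsch\<close> allows each set at most 5 points in each of two cosets.\<close>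

lemma big_fiber:
  assumes r: "r \<in> B" and big: "card (A r) \<ge> 9"
    and no: "\<And>M. is_subgroup M \<Longrightarrow> M \<subseteq> G \<Longrightarrow> card G = 2 * card M \<Longrightarrow> B \<inter> shift r M \<noteq> {r}"
  shows "card (A r) \<le> 10" "card B \<le> 11"
proof -
  let ?D = "shift r B - {0}"
  have DG: "?D \<subseteq> G"
  proof
    fix x assume "x \<in> ?D"
    then have "r + x \<in> B" by simp
    from add_in_G[OF r this] show "x \<in> G" by simp
  qed
  have sf: "x + y \<notin> ?D" if xy: "x \<in> ?D" "y \<in> ?D" "x \<noteq> y" for x y
  proof
    assume z: "x + y \<in> ?D"
    have K: "is_subgroup {0, x, y, x + y}" by (rule is_subgroupI) (auto simp: add_ac)
    have "distinct [0, x, y, x + y]" using xy by auto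
    from distinct_card[OF this] have 4: "card {0, x, y, x + y} = 4" by simp
    have xG: "x \<in> G" "y \<in> G" "x + y \<in> G" using subsetD[OF DG] xy(1,2) z by blast+
    have "r + k \<in> B" if "k \<in> {0, x, y, x + y}" "k \<noteq> 0" for k
    proof -
      have "k \<in> shift r B" using that xy(1,2) z by blast
      then show ?thesis by simp
    qed
    then have "card (A r) * card {0, x, y, x + y} \<le> card G"
      using fiber_mult[OF K] xG is_subgroup_0[OF subgroup_G] by blast
    then show False using big 4 card_G by simp
  qed
  have 0: "0 \<notin> ?D" by simp
  obtain Y where Y: "Y \<subseteq> ?D" "card Y = 5" "\<Sum>Y = 0"
  proof (rule hyperplane_or_circuit[OF subgroup_G card_G DG 0 sf])
    fix M assume M: "is_subgroup M" "M \<subseteq> G" "card G = 2 * card M" "M \<inter> ?D = {}"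
    have "s = r" if "s \<in> B" "r + s \<in> M" for s
    proof (rule ccontr)
      assume "s \<noteq> r"
      then have "r + s \<in> ?D" using that(1) by simp
      then show False using that(2) M(4) by blast
    qed
    then have "B \<inter> shift r M \<subseteq> {r}" by (simp add: subset_iff)
    moreover have "r \<in> B \<inter> shift r M" using r is_subgroup_0[OF M(1)] by simp
    ultimately have "B \<inter> shift r M = {r}" by blast
    then show thesis using no M by blast
  qed
  have Y0: "0 \<notin> Y" using Y(1) by blast
  have YG: "Y \<subseteq> G" using Y(1) DG by blast
  have sfY: "x + y \<notin> Y" if "x \<in> Y" "y \<in> Y" "x \<noteq> y" for x y
    using sf[of x y] that Y(1) by blast
  obtain W where W: "is_subgroup W" "W \<subseteq> G" "card W = 16" "Y \<subseteq> W"
    by (rule circuit_span[OF subgroup_G YG Y(2,3) Y0 sfY])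
  have W2: "card G = 2 * card W" using W(3) card_G by simp
  obtain g where g: "G = W \<union> shift g W" using index2_obtain[OF subgroup_G W(1,2) W2] by metis
  note cl = clebsch[OF W(1,3,4) Y0 Y(2,3)]
  have two: "card X \<le> 10" if X: "X \<subseteq> shift c G" and d: "difference_set X \<inter> Y = {}" for X c
  proof -
    have "shift c G = shift c W \<union> shift (c + g) W" by (subst g) (auto simp: add_ac)
    then have "card X \<le> card (X \<inter> shift c W) + card (X \<inter> shift (c + g) W)"
      using X by (intro card_le_two_parts) simp
    moreover have "card (X \<inter> shift c W) \<le> 5"
      by (rule cl) (use d in \<open>auto simp: difference_set_def\<close>)
    moreover have "card (X \<inter> shift (c + g) W) \<le> 5"
      by (rule cl) (use d in \<open>auto simp: difference_set_def\<close>)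
    ultimately show ?thesis by simp
  qed
  show "card (A r) \<le> 10"
  proof (rule two[OF A_sub])
    have "d \<notin> Y" if "d \<in> difference_set (A r)" for d
      using difference_set_A[OF that] Y(1) by auto
    then show "difference_set (A r) \<inter> Y = {}" by blast
  qed
  have "card ?D \<le> 10"
  proof (rule two[of ?D 0])
    show "?D \<subseteq> shift 0 G" using DG by auto
    have "d \<notin> Y" if "d \<in> difference_set ?D" for d
    proof -
      obtain x y where "x \<in> ?D" "y \<in> ?D" "x \<noteq> y" "d = x + y" using \<open>d \<in> difference_set ?D\<close> unfolding difference_set_def by blast
      then show ?thesis using sf Y(1) by blast
    qed
    then show "difference_set ?D \<inter> Y = {}" by blast
  qed
  moreover have "card (shift r B) = Suc (card ?D)"
    using r finite_B by (intro card.remove) auto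
  ultimately show "card B \<le> 11" by simp
qed

text \<open>Everything is measured against the gaps Z, at most six, in the coset opposite the hexad
  Q. Points of C with large fibers (T) are new triple sums of Z. Points of Q with large fibers (K)
  have isolating flats, which leave W by \<open>separated_zero_sum\<close> and so put a plane into
  Z; planes in Z reduce the number of new triple sums.\<close>

lemma hexad_bound:
  assumes le8: "\<And>s. s \<in> B \<Longrightarrow> card (A s) \<le> 8" and m: "card B \<ge> 16"
    and W: "is_subgroup W" "W \<subseteq> G" "card W = 16" and r0: "r0 \<in> B"
    and hex: "card (B \<inter> shift r0 W) = 6" "\<Sum>(B \<inter> shift r0 W) = 0"
  shows "card R \<le> 124"
proof -
  define Q where "Q = B \<inter> shift r0 W"
  define Z where "Z = shift a G - shift r0 W - B"
  have W2: "card G = 2 * card W" using W(3) card_G by simp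
  note oc = other_coset[OF W(1,2) W2 r0 Q_def Z_def]
  have cQ: "card Q = 6" "\<Sum>Q = 0" using hex by (auto simp: Q_def)
  have QB: "Q \<subseteq> B" by (auto simp: Q_def)
  have finQ: "finite Q" using QB finite_B finite_subset by blast
  define C where "C = B - Q"
  have finC: "finite C" using finite_B by (simp add: C_def)
  have cC: "card C = card B - 6" unfolding C_def using card_Diff_subset[OF finQ QB] cQ by simp
  have cZ: "card Z + card C = 16" "card C \<ge> 10" using oc(1) cQ W(3) cC m by auto
  \<comment> \<open>Size 7 = 5 + 2 is the threshold of \<open>large_fiber_isolated\<close>. For T,
    size 5 guarantees three elements in one coset of W, as \<open>fiber_triple\<close>
    needs.\<close>
  define K where "K = {s\<in>Q. card (A s) \<ge> 7}"
  define T where "T = {s\<in>C. card (A s) \<ge> 5}"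
  have finK: "finite K" "card K \<le> 6" using finQ cQ(1) card_mono[OF finQ, of K] by (auto simp: K_def)
  have finT: "finite T" "card T \<le> card C" using finC card_mono[OF finC, of T] by (auto simp: T_def)
  have le8': "s \<in> Q \<Longrightarrow> card (A s) \<le> 8" "s \<in> C \<Longrightarrow> card (A s) \<le> 8" for s
    using le8[of s] unfolding Q_def C_def by blast+
  have "(\<Sum>s\<in>Q. card (A s)) \<le> 6 * card Q + 2 * card K"
    by (rule sum_le_two_level[OF finQ]) (use le8' in \<open>auto simp: K_def\<close>)
  moreover have "(\<Sum>s\<in>C. card (A s)) \<le> 4 * card C + 4 * card T"
    by (rule sum_le_two_level[OF finC]) (use le8' in \<open>auto simp: T_def\<close>)
  moreover have "card R = (\<Sum>s\<in>C. card (A s)) + (\<Sum>s\<in>Q. card (A s))"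
    unfolding card_R C_def by (rule sum.subset_diff[OF QB finite_B])
  ultimately have total: "card R \<le> 36 + 2 * card K + 4 * card C + 4 * card T" using cQ by simp
  have TZ: "T \<subseteq> triple_sums Z - Z"
  proof
    fix s assume s: "s \<in> T"
    obtain g where g: "G = W \<union> shift g W" using index2_obtain[OF subgroup_G W(1,2) W2] by metis
    have "shift b G = shift b W \<union> shift (b + g) W" by (subst g) (auto simp: add_ac)
    then have "card (A s) \<le> card (A s \<inter> shift b W) + card (A s \<inter> shift (b + g) W)"
      using A_sub[of s] by (intro card_le_two_parts) simp
    moreover have "card (A s) \<ge> 5" using s by (simp add: T_def)
    ultimately have "card (A s \<inter> shift b W) \<ge> 3 \<or> card (A s \<inter> shift (b + g) W) \<ge> 3" by linarith
    then have "s \<in> triple_sums (shift s W - B)"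
      using fiber_triple[OF W(1), of "A s \<inter> shift b W" s b] fiber_triple[OF W(1), of "A s \<inter> shift (b + g) W" s "b + g"]
      by blast
    moreover have sC: "s \<in> B - Q" using s by (simp add: T_def C_def)
    ultimately show "s \<in> triple_sums Z - Z" using oc(4)[OF sC] by (simp add: Z_def)
  qed
  have cT: "card T \<le> card (triple_sums Z - Z)"
    using TZ card_triple_sums(1)[OF oc(2)] by (intro card_mono) auto
  have cT': "card T \<le> card Z choose 3"
    using cT card_triple_sums(2)[OF oc(2)] card_mono[OF card_triple_sums(1)[OF oc(2)] Diff_subset, of Z] by linarith
  have flat: "\<exists>U p. is_subgroup U \<and> U \<subseteq> W \<and> card U = 4 \<and> shift p U \<subseteq> Z \<and> B \<inter> shift s U = {s}" if s: "s \<in> K" for s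
  proof -
    have sQ: "s \<in> Q" "s \<in> B" "card (A s) \<ge> 5 + 2" using s QB by (auto simp: K_def)
    have c32: "card G = 2 ^ 5" using card_G by simp
    obtain H where H: "is_subgroup H" "card H = 8" "H \<subseteq> G" "B \<inter> shift s H = {s}"
      by (rule large_fiber_isolated[OF c32 _ _ sQ(2,3)]) auto
    have "r0 + s \<in> W" using sQ(1) by (simp add: Q_def)
    then have sW: "shift s W = shift r0 W" using shift_eq[OF W(1), of r0 s] by simp
    have "\<not> H \<subseteq> W"
    proof
      assume HW: "H \<subseteq> W"
      have "Q \<inter> shift s H = {s}" using H(4) sQ(1) QB by blast
      then show False
        using separated_zero_sum[OF W(1) H(1) HW _ finQ, of s] W(3) H(2) cQ sW by (simp add: Q_def)
    qed
    obtain U p where "is_subgroup U" "U \<subseteq> W" "card U = 4" "shift p U \<subseteq> shift a G - shift s W - B" "B \<inter> shift s U = {s}"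
      by (rule isolated_split[OF W(1,2) W2 sQ(2) H(1,3,2,4) \<open>\<not> H \<subseteq> W\<close>])
    then show ?thesis unfolding sW Z_def[symmetric] by blast
  qed
  consider "card C = 10" | "card C = 11" | "card C \<in> {12, 13, 14, 15, 16}"
    using cZ by fastforce
  then show ?thesis
  proof cases
    case 3
    then have "card Z = 16 - card C" using cZ by simp
    then have "4 * card C + 4 * card T \<le> 76"
      using 3 cT' by (auto simp: binomial_eq_0 eval_nat_numeral)
    then show ?thesis using total finK by simp
  next
    case 2
    then have Z5: "card Z = 5" using cZ by simp
    show ?thesis
    proof (cases "K = {}")
      case True
      have "(5::nat) choose 3 = 10" by (simp add: eval_nat_numeral)
      then show ?thesis using total 2 cT' Z5 True by simp
    next
      case False
      then obtain U p where U: "is_subgroup U" "card U = 4" "shift p U \<subseteq> Z" using flat by blast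
      have "card (Z - shift p U) = 1" using card_Diff_subset[OF _ U(3)] is_subgroup_finite[OF U(1)] U(2) Z5 by simp
      then obtain z where "Z - shift p U = {z}" by (auto simp: card_1_singleton_iff)
      from triples_flat_point[OF U(1,2) eq_insert_if_Diff[OF U(3) this]] have "card T \<le> 3" using cT by simp
      then show ?thesis using total 2 finK by simp
    qed
  next
    case 1
    then have Z6: "card Z = 6" using cZ by simp
    show ?thesis
    \<comment> \<open>Four points in K and all ten points of C in T give exactly 36 + 8 + 40 + 40 =
      124; six points in T give at most 112.\<close>
    proof (cases "card K \<le> 4 \<or> card T \<le> 6")
      case True
      then show ?thesis using total 1 finK finT by auto
    next
      case False
      then have T7: "card (triple_sums Z - Z) \<ge> 7" using cT by simp
      have "K \<noteq> {}" using False by auto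
      then obtain s0 where s0: "s0 \<in> K" by blast
      obtain U p where U: "is_subgroup U" "U \<subseteq> W" "card U = 4" "shift p U \<subseteq> Z" using flat[OF s0] by blast
      \<comment> \<open>All planes in Z have direction U, so the points of K lie in different cosets
        of U in W. There are only four, against at least five points in K.\<close>
      have "card K * card U \<le> card W"
      proof (rule card_packing[OF W(1) U(1,2)])
        show "K \<subseteq> shift r0 W" by (auto simp: K_def Q_def)
        fix s t assume st: "s \<in> K" "t \<in> K" "s \<noteq> t"
        obtain U' p' where U': "is_subgroup U'" "card U' = 4" "shift p' U' \<subseteq> Z" "B \<inter> shift s U' = {s}"
          using flat[OF st(1)] by blast
        have "U' = U" by (rule flat_unique[OF U(1,3,4) U'(1-3) Z6 T7])
        moreover have "t \<in> B" using st(2) QB unfolding K_def by blast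
        then have "t \<notin> shift s U'" using Int_singletonD[OF U'(4)] st(3) by metis
        ultimately show "s + t \<notin> U" by simp
      qed
      then show ?thesis using False U(3) W(3) by simp
    qed
  qed
qed

end

section \<open>Oddtown for 3-dimensional flats\<close>

context boolean_group begin

lemma even_card_invariant:
  assumes "finite S" "v \<noteq> 0" "\<And>x. x \<in> S \<Longrightarrow> x + v \<in> S"
  shows "even (card S)"
  using assms(1,3)
proof (induction S rule: finite_psubset_induct)
  case (psubset S)
  show ?case
  proof (cases "S = {}")
    case False
    then obtain x where x: "x \<in> S" by blast
    let ?S = "S - {x, x + v}"
    have xv: "x + v \<in> S" "x \<noteq> x + v" using psubset.prems x assms(2) by auto
    have "y + v \<in> ?S" if "y \<in> ?S" for y
    proof -
      have "y + v \<noteq> x"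
      proof
        assume "y + v = x"
        then have "x + v = y" by (auto simp: add_ac)
        then show False using that by blast
      qed
      then show ?thesis using that psubset.prems by auto
    qed
    then have "even (card ?S)" using psubset.IH[of ?S] x by blast
    moreover have "card S = card ?S + 2"
    proof -
      have "card {x, x + v} = 2" using xv(2) by (simp only: card_2_iff') blast
      moreover have "card {x, x + v} \<le> card S" using psubset.hyps x xv(1) by (intro card_mono) auto
      ultimately show ?thesis using card_Diff_subset[of "{x, x + v}" S] x xv(1) by simp
    qed
    ultimately show ?thesis by simp
  qed simp
qed

text \<open>Since 3 + 3 > 5, the two directions share a nonzero v, and translation by v pairs up the
  points of the intersection.\<close>

lemma even_card_flats:
  assumes G: "is_subgroup G" "card G = 32" and K: "is_subgroup K" "K \<subseteq> G" "card K = 8" and L: "is_subgroup L" "L \<subseteq> G" "card L = 8"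
  shows "even (card (shift x K \<inter> shift y L))"
proof -
  have "\<exists>v. v \<in> K \<and> v \<in> L \<and> v \<noteq> 0"
  proof (rule ccontr)
    assume n: "\<not> ?thesis"
    have "card K * card L \<le> card G"
    proof (rule card_packing[OF G(1) L(1,2)])
      show "K \<subseteq> shift 0 G" using K(2) by auto
      fix u v assume uv: "u \<in> K" "v \<in> K" "u \<noteq> v"
      have "u + v \<in> K" using uv K(1) is_subgroup_add by blast
      moreover have "u + v \<noteq> 0" using uv(3) by simp
      ultimately show "u + v \<notin> L" using n by blast
    qed
    then show False using G K L by simp
  qed
  then obtain v where v: "v \<in> K" "v \<in> L" "v \<noteq> 0" by blast
  show ?thesis
  proof (rule even_card_invariant[OF _ v(3)])
    show "finite (shift x K \<inter> shift y L)" using is_subgroup_finite[OF K(1)] by simp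
    fix z assume "z \<in> shift x K \<inter> shift y L"
    then have "x + z \<in> K" "y + z \<in> L" by simp_all
    then have "(x + z) + v \<in> K" "(y + z) + v \<in> L" using v K(1) L(1) is_subgroup_add by blast+
    then show "z + v \<in> shift x K \<inter> shift y L" by (simp add: add.assoc)
  qed
qed

text \<open>Complete d to a basis d, e1, ..., e4 and take the spans of d, e1, e2 and of d, e3,
  e4.\<close>

lemma two_flats:
  assumes G: "is_subgroup G" "card G = 32" and d: "d \<in> G" "d \<noteq> 0"
  obtains K L where "is_subgroup K" "K \<subseteq> G" "card K = 8" "is_subgroup L" "L \<subseteq> G" "card L = 8" "K \<inter> L = {0, d}"
proof -
  have ext: "\<exists>e. e \<in> G \<and> e \<notin> H" if "H \<subseteq> G" "card H < 32" for H
    using that G(2) by (metis nat_neq_iff subsetI subset_antisym)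
  have sub: "is_subgroup (H \<union> shift e H) \<and> H \<union> shift e H \<subseteq> G \<and> card (H \<union> shift e H) = 2 * card H"
    if H: "is_subgroup H" "H \<subseteq> G" "e \<in> G" "e \<notin> H" for H e
  proof -
    have "shift e H \<subseteq> G"
    proof
      fix x assume "x \<in> shift e H"
      then have "e + x \<in> G" using H(2) by auto
      then show "x \<in> G" using is_subgroup_add_cancel[OF G(1) H(3)] by simp
    qed
    then show ?thesis using is_subgroup_extend[OF H(1,4)] H(2) by blast
  qed
  have disj: "x \<notin> shift e H" if "is_subgroup H" "e \<notin> H" "x \<in> H" for H e x
    using that is_subgroup_add_cancel'[OF that(1,3)] by simp
  let ?K1 = "{0, d}"
  have K1: "is_subgroup ?K1" "?K1 \<subseteq> G" "card ?K1 = 2"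
    using d is_subgroup_0[OF G(1)] by (auto intro!: is_subgroupI)
  obtain e1 where e1: "e1 \<in> G" "e1 \<notin> ?K1" using ext[OF K1(2)] K1(3) by auto
  define K2 where "K2 = ?K1 \<union> shift e1 ?K1"
  have K2: "is_subgroup K2" "K2 \<subseteq> G" "card K2 = 4" using sub[OF K1(1,2) e1] K1(3) unfolding K2_def by auto
  obtain e2 where e2: "e2 \<in> G" "e2 \<notin> K2" using ext[OF K2(2)] K2(3) by auto
  define K where "K = K2 \<union> shift e2 K2"
  have K: "is_subgroup K" "K \<subseteq> G" "card K = 8" using sub[OF K2(1,2) e2] K2(3) unfolding K_def by auto
  obtain e3 where e3: "e3 \<in> G" "e3 \<notin> K" using ext[OF K(2)] K(3) by auto
  define K3 where "K3 = K \<union> shift e3 K"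
  have K3: "is_subgroup K3" "K3 \<subseteq> G" "card K3 = 16" using sub[OF K(1,2) e3] K(3) unfolding K3_def by auto
  obtain e4 where e4: "e4 \<in> G" "e4 \<notin> K3" using ext[OF K3(2)] K3(3) by auto
  have K1K: "?K1 \<subseteq> K" unfolding K_def K2_def by blast
  have e3': "e3 \<notin> ?K1" using e3(2) K1K by blast
  define L2 where "L2 = ?K1 \<union> shift e3 ?K1"
  have L2: "is_subgroup L2" "L2 \<subseteq> G" "card L2 = 4" using sub[OF K1(1,2) e3(1) e3'] K1(3) unfolding L2_def by auto
  have sh: "shift e H \<subseteq> shift e H'" if "H \<subseteq> H'" for e H H' using that by auto
  have L2K3: "L2 \<subseteq> K3" unfolding L2_def K3_def using K1K sh[OF K1K, of e3] by blast
  have e4': "e4 \<notin> L2" using e4(2) L2K3 by blast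
  define L where "L = L2 \<union> shift e4 L2"
  have L: "is_subgroup L" "L \<subseteq> G" "card L = 8" using sub[OF L2(1,2) e4(1) e4'] L2(3) unfolding L_def by auto
  have "K \<inter> L \<subseteq> ?K1"
  proof
    fix x assume x: "x \<in> K \<inter> L"
    then have "x \<in> K3" unfolding K3_def by blast
    then have "x \<notin> shift e4 K3" by (rule disj[OF K3(1) e4(2)])
    then have "x \<notin> shift e4 L2" using sh[OF L2K3, of e4] by blast
    moreover have "x \<notin> shift e3 K" using x by (intro disj[OF K(1) e3(2)]) blast
    then have "x \<notin> shift e3 ?K1" using sh[OF K1K, of e3] by blast
    ultimately show "x \<in> ?K1" using x unfolding L_def L2_def by blast
  qed
  moreover have "?K1 \<subseteq> K \<inter> L" using K1K unfolding L_def L2_def by blast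
  ultimately have "K \<inter> L = ?K1" by (rule subset_antisym)
  then show ?thesis using that K L by blast
qed

text \<open>Oddtown for the sets \<open>shift r (H r) - {r}\<close>, which have odd size and even pairwise
  intersections. In the case of equality they form an orthonormal basis of the power set of \<open>Z\<close>,
  and the second claim is Parseval's identity for two flats.\<close>

lemma oddtown_flats:
  assumes G: "is_subgroup G" "card G = 32" and T: "T \<subseteq> B" "B \<subseteq> shift a G" and Z: "Z = shift a G - B"
    and H: "\<And>r. r \<in> T \<Longrightarrow> is_subgroup (H r) \<and> H r \<subseteq> G \<and> card (H r) = 8 \<and> B \<inter> shift r (H r) = {r}"
  shows "card T \<le> card Z"
    and "card T = card Z \<Longrightarrow> is_subgroup K \<Longrightarrow> K \<subseteq> G \<Longrightarrow> card K = 8 \<Longrightarrow> is_subgroup L \<Longrightarrow> L \<subseteq> G \<Longrightarrow> card L = 8 \<Longrightarrow>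
      even (card (shift x K \<inter> shift y L \<inter> (T \<union> Z)))"
proof -
  have finZ: "finite Z" unfolding Z using is_subgroup_finite[OF G(1)] by simp
  have finT: "finite T" using T is_subgroup_finite[OF G(1)] finite_subset[of T "shift a G"] by simp
  define F where "F r = shift r (H r)" for r
  \<comment> \<open>The sum over F_2 of the traces of the flats \<open>F r\<close> on Z, as a map
    from subsets of T to subsets of Z.\<close>
  define S where "S X = {p\<in>Z. odd (card {r\<in>X. p \<in> F r})}" for X
  \<comment> \<open>The flat \<open>F r\<close> meets x + K in an even number of points, and all its
    points other than r lie in Z.\<close>
  have cross: "odd (card {p \<in> Z \<inter> shift x K. p \<in> F r}) \<longleftrightarrow> r \<in> shift x K"
    if r: "r \<in> T" and K: "is_subgroup K" "K \<subseteq> G" "card K = 8" for r x K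
  proof -
    let ?X = "{p \<in> Z \<inter> shift x K. p \<in> F r}"
    note Hr = H[OF r]
    have "a + r \<in> G" using r T by auto
    then have "shift r G = shift a G" using shift_eq[OF G(1), of a r] by simp
    moreover have "F r \<subseteq> shift r G" unfolding F_def using Hr by auto
    ultimately have FG: "F r \<subseteq> shift a G" by simp
    have BF: "B \<inter> F r = {r}" using Hr by (simp add: F_def)
    have finX: "finite ?X" using finZ by simp
    have "even (card (F r \<inter> shift x K))"
      unfolding F_def by (rule even_card_flats[OF G]) (use Hr K in auto)
    moreover have "F r \<inter> shift x K = (if r \<in> shift x K then insert r ?X else ?X)"
      using FG BF unfolding Z by auto
    moreover have "r \<notin> ?X" using r T unfolding Z by blast
    ultimately show ?thesis using finX by (auto split: if_splits)
  qed
  \<comment> \<open>Summing \<open>cross\<close> over X by double counting: S preserves the parity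
    of intersections with 3-dimensional flats.\<close>
  have par: "even (card (S X \<inter> shift x K)) \<longleftrightarrow> even (card (X \<inter> shift x K))"
    if X: "X \<subseteq> T" and K: "is_subgroup K" "K \<subseteq> G" "card K = 8" for X x K
  proof -
    have finX: "finite X" using X finT finite_subset by blast
    let ?P = "Z \<inter> shift x K"
    have finP: "finite ?P" using finZ by simp
    have SP: "S X \<inter> shift x K = {p\<in>?P. odd (card {r\<in>X. p \<in> F r})}" unfolding S_def by blast
    have "even (card (S X \<inter> shift x K)) \<longleftrightarrow> even (\<Sum>p\<in>?P. card {r\<in>X. p \<in> F r})"
      unfolding SP by (rule even_sum_iff[OF finP, symmetric])
    also have "(\<Sum>p\<in>?P. card {r\<in>X. p \<in> F r}) = (\<Sum>r\<in>X. card {p\<in>?P. p \<in> F r})"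
      unfolding card_eq_sum using comm_monoid_add_class.sum.swap_restrict[OF finP finX, of "\<lambda>_ _. 1 :: nat" "\<lambda>p r. p \<in> F r"] .
    also have "even \<dots> \<longleftrightarrow> even (card {r\<in>X. odd (card {p\<in>?P. p \<in> F r})})"
      by (rule even_sum_iff[OF finX])
    also have "{r\<in>X. odd (card {p\<in>?P. p \<in> F r})} = X \<inter> shift x K"
      using cross[OF _ K] X by blast
    finally show ?thesis .
  qed
  \<comment> \<open>Testing S X against \<open>F r\<close> itself decides whether r is in X, since X
    meets \<open>F r\<close> at most in r. This makes S injective.\<close>
  have recover: "r \<in> X \<longleftrightarrow> odd (card (S X \<inter> F r))" if X: "X \<subseteq> T" and r: "r \<in> T" for X r
  proof -
    have "X \<inter> F r = (if r \<in> X then {r} else {})"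
      using H[OF r] X T(1) unfolding F_def by auto
    then have "r \<in> X \<longleftrightarrow> odd (card (X \<inter> F r))" by auto
    then show ?thesis using par[OF X, of "H r" r] H[OF r] unfolding F_def by blast
  qed
  have inj: "inj_on S (Pow T)"
  proof (rule inj_onI)
    fix X Y assume XY: "X \<in> Pow T" "Y \<in> Pow T" "S X = S Y"
    then have "r \<in> X \<longleftrightarrow> r \<in> Y" if "r \<in> T" for r
      using recover[of X r] recover[of Y r] that by simp
    then show "X = Y" using XY(1,2) by blast
  qed
  have SZ: "S ` Pow T \<subseteq> Pow Z" unfolding S_def by blast
  have "card (Pow T) \<le> card (Pow Z)"
    by (rule card_inj_on_le[OF inj SZ]) (use finZ in simp)
  then show "card T \<le> card Z" using finT finZ by (simp add: card_Pow)
  assume c: "card T = card Z" and K: "is_subgroup K" "K \<subseteq> G" "card K = 8" and L: "is_subgroup L" "L \<subseteq> G" "card L = 8"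
  \<comment> \<open>Equal cardinalities make S surjective. So the trace of y + L on Z is S X for
    some X, \<open>recover\<close> identifies X as the trace on T, and \<open>par\<close> compares
    the two against x + K.\<close>
  have "S ` Pow T = Pow Z"
    by (rule card_subset_eq[OF _ SZ]) (use finZ finT c card_image[OF inj] in \<open>simp_all add: card_Pow\<close>)
  then obtain X where X: "X \<subseteq> T" "S X = Z \<inter> shift y L" by (metis PowD PowI Int_lower1 image_iff)
  have "r \<in> X \<longleftrightarrow> r \<in> shift y L" if "r \<in> T" for r
  proof -
    have "S X \<inter> F r = {p \<in> Z \<inter> shift y L. p \<in> F r}" unfolding X(2) by blast
    then show ?thesis using recover[OF X(1) that] cross[OF that L, of y] by simp
  qed
  then have XT: "X = T \<inter> shift y L" using X(1) by blast
  have "even (card (Z \<inter> shift y L \<inter> shift x K)) \<longleftrightarrow> even (card (T \<inter> shift y L \<inter> shift x K))"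
    using par[OF X(1) K, of x] unfolding X(2) by (simp only: XT)
  moreover have "shift x K \<inter> shift y L \<inter> (T \<union> Z) = (T \<inter> shift y L \<inter> shift x K) \<union> (Z \<inter> shift y L \<inter> shift x K)"
    by blast
  moreover have "(T \<inter> shift y L \<inter> shift x K) \<inter> (Z \<inter> shift y L \<inter> shift x K) = {}"
    using T(1) unfolding Z by blast
  ultimately show "even (card (shift x K \<inter> shift y L \<inter> (T \<union> Z)))"
    using card_Un_disjoint[of "T \<inter> shift y L \<inter> shift x K" "Z \<inter> shift y L \<inter> shift x K"] finT finZ by simp
qed

text \<open>For x in T \<union> Z and y in B - T, two flats that meet only in x and y would have
  exactly one common point in T \<union> Z, an odd number.\<close>

lemma oddtown_flats_eq:
  assumes G: "is_subgroup G" "card G = 32" and T: "T \<subseteq> B" "B \<subseteq> shift a G" and Z: "Z = shift a G - B"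
    and H: "\<And>r. r \<in> T \<Longrightarrow> is_subgroup (H r) \<and> H r \<subseteq> G \<and> card (H r) = 8 \<and> B \<inter> shift r (H r) = {r}"
    and c: "card T = card Z"
  shows "T \<union> Z = {} \<or> T = B"
proof (rule ccontr)
  assume n: "\<not> ?thesis"
  then obtain x where x: "x \<in> T \<union> Z" by blast
  obtain y where y: "y \<in> B" "y \<notin> T" using n T(1) by blast
  have yU: "y \<notin> T \<union> Z" using y unfolding Z by blast
  have "a + x \<in> G" "a + y \<in> G" using x y T unfolding Z by auto
  then have "(a + x) + (a + y) \<in> G" using is_subgroup_add[OF G(1)] by blast
  then have d: "x + y \<in> G" by (simp add: add_ac)
  have ne: "x + y \<noteq> 0" using x yU by auto
  obtain K L where KL: "is_subgroup K" "K \<subseteq> G" "card K = 8" "is_subgroup L" "L \<subseteq> G" "card L = 8" "K \<inter> L = {0, x + y}"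
    by (rule two_flats[OF G d ne])
  have "shift x K \<inter> shift x L = shift x (K \<inter> L)" by auto
  also have "\<dots> = {x, y}" unfolding KL(7) by auto
  finally have "shift x K \<inter> shift x L \<inter> (T \<union> Z) = {x}" using x yU by blast
  then show False using oddtown_flats(2)[OF G T Z H c KL(1-6), of x x] by simp
qed

end

section \<open>Excluding equality, and the bound 124\<close>

context config5 begin

text \<open>The analogue of \<open>fiber_triple\<close> for a flat in place of a fiber: s is the sum
  of s + u, s + v and s + (u + v).\<close>

lemma flat_triple:
  assumes U: "is_subgroup U" "U \<subseteq> W" "card U \<ge> 3" and s: "s \<in> B" "B \<inter> shift s U = {s}"
  shows "s \<in> triple_sums (shift s W - B)"
proof -
  have "card (U - {0}) \<ge> 2" using U(3) is_subgroup_0[OF U(1)] by simp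
  then obtain X where "X \<subseteq> U - {0}" "card X = 2" by (meson obtain_subset_with_card_n)
  then obtain u v where uv: "u \<in> U" "v \<in> U" "u \<noteq> 0" "v \<noteq> 0" "u \<noteq> v" by (auto simp: card_2_iff)
  have in_W: "s + w \<in> shift s W - B" if "w \<in> U" "w \<noteq> 0" for w
  proof -
    have "s + w \<in> shift s U" "s + w \<noteq> s" using that by simp_all
    then have "s + w \<notin> B" using s(2) by blast
    then show ?thesis using that(1) U(2) by auto
  qed
  have "s + u \<in> shift s W - B" "s + v \<in> shift s W - B" "s + (u + v) \<in> shift s W - B"
    using uv in_W[of u] in_W[of v] in_W[of "u + v"] is_subgroup_add[OF U(1)] by simp_all
  moreover have "s = (s + u) + (s + v) + (s + (u + v))" by (simp add: add_ac)
  moreover have "s + u \<noteq> s + v" "s + u \<noteq> s + (u + v)" "s + v \<noteq> s + (u + v)" using uv by simp_all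
  ultimately show ?thesis unfolding triple_sums_def by blast
qed

text \<open>The 15 points of B other than r are spread over the three other cosets of H in r + G, so
  one of these has at most 5. Together with r + H it forms a coset of W with at most 1 + 5 points of
  B.\<close>

lemma small_coset:
  assumes r: "r \<in> B" and H: "is_subgroup H" "H \<subseteq> G" "card H = 8" "B \<inter> shift r H = {r}" and c: "card B = 16"
  obtains W where "is_subgroup W" "W \<subseteq> G" "card W = 16" "card (B \<inter> shift r W) \<le> 6"
proof -
  have "H \<noteq> G" using H(3) card_G by auto
  then obtain g where g: "g \<in> G" "g \<notin> H" using H(2) by blast
  have ext: "is_subgroup (H \<union> shift e H) \<and> H \<union> shift e H \<subseteq> G \<and> card (H \<union> shift e H) = 16" if "e \<in> G" "e \<notin> H" for e
  proof -
    have "shift e H \<subseteq> G"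
    proof
      fix x assume "x \<in> shift e H"
      then have "e + x \<in> G" using H(2) by auto
      then show "x \<in> G" using is_subgroup_add_cancel[OF subgroup_G that(1)] by simp
    qed
    then show ?thesis using is_subgroup_extend[OF H(1) that(2)] H(2,3) by auto
  qed
  let ?M = "H \<union> shift g H"
  have "?M \<noteq> G" using ext[OF g] card_G by auto
  then obtain f where f: "f \<in> G" "f \<notin> H" "f \<notin> shift g H" using ext[OF g] by blast
  have fg: "f + g \<in> G" "f + g \<notin> H" using f g is_subgroup_add[OF subgroup_G] by (auto simp: add.commute)
  define N where "N e = B \<inter> shift (r + e) H" for e
  have disj: "N e \<inter> N e' = {}" if "e + e' \<notin> H" for e e'
  proof (rule ccontr)
    assume "\<not> ?thesis"
    then obtain x where "(r + e) + x \<in> H" "(r + e') + x \<in> H" by (auto simp: N_def)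
    then have "((r + e) + x) + ((r + e') + x) \<in> H" using is_subgroup_add[OF H(1)] by blast
    then show False using that by (simp add: add_ac)
  qed
  have finN: "finite (N e)" for e unfolding N_def using finite_B by simp
  have "N g \<inter> N f = {}" "(N g \<union> N f) \<inter> N (f + g) = {}"
    using disj[of g f] disj[of g "f + g"] disj[of f "f + g"] f g by (auto simp: add_ac)
  then have "card (N g \<union> N f \<union> N (f + g)) = card (N g) + card (N f) + card (N (f + g))"
    using finN by (simp add: card_Un_disjoint)
  moreover have "N g \<union> N f \<union> N (f + g) \<subseteq> B - {r}"
    using f(2) g(2) fg(2) unfolding N_def by (auto simp: add_ac)
  then have "card (N g \<union> N f \<union> N (f + g)) \<le> 15"
    using card_mono[of "B - {r}" "N g \<union> N f \<union> N (f + g)"] finite_B r c by simp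
  ultimately have "card (N g) \<le> 5 \<or> card (N f) \<le> 5 \<or> card (N (f + g)) \<le> 5" by linarith
  then obtain e where e: "e \<in> G" "e \<notin> H" "card (N e) \<le> 5" using f g fg by blast
  have "shift r (H \<union> shift e H) = shift r H \<union> shift (r + e) H" by (auto simp: add_ac)
  then have "B \<inter> shift r (H \<union> shift e H) = {r} \<union> N e" unfolding N_def using H(4) by blast
  then have "card (B \<inter> shift r (H \<union> shift e H)) \<le> 6"
    using card_Un_le[of "{r}" "N e"] e(3) by simp
  then show ?thesis using that ext[OF e(1,2)] by blast
qed

text \<open>If the small coset has q points of B, the opposite one has 16 - q points, all new triple
  sums of its q gaps; this forces q = 6. An even zero-sum subset X of the six points now acts like a
  hexad: its isolating flats put planes of one common direction U into Z. So a point of X shares its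
  coset of U with no other point of Q, and X with one further point of Q needs more than the four
  cosets of U in W.\<close>

lemma not_all_isolated:
  assumes c: "card B = 16" and iso: "\<And>r. r \<in> B \<Longrightarrow> isolated r"
  shows False
proof -
  have "B \<noteq> {}" using c by auto
  then obtain r where r: "r \<in> B" by blast
  obtain H where H: "is_subgroup H" "H \<subseteq> G" "card H = 8" "B \<inter> shift r H = {r}"
    using iso[OF r] unfolding isolated_def by blast
  obtain W where W: "is_subgroup W" "W \<subseteq> G" "card W = 16" "card (B \<inter> shift r W) \<le> 6"
    by (rule small_coset[OF r H c])
  have W2: "card G = 2 * card W" using W(3) card_G by simp
  define Q where "Q = B \<inter> shift r W"
  define Z where "Z = shift a G - shift r W - B"
  note oc = other_coset[OF W(1,2) W2 r Q_def Z_def]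
  have QB: "Q \<subseteq> B" unfolding Q_def by blast
  have finQ: "finite Q" using QB finite_B finite_subset by blast
  have cZ: "card Z = card Q" "card Q \<le> 6" using oc(1,3) W(3,4) c by (auto simp: Q_def)
  have CZ: "B - Q \<subseteq> triple_sums Z - Z"
  proof
    fix s assume s: "s \<in> B - Q"
    obtain K where K: "is_subgroup K" "K \<subseteq> G" "card K = 8" "B \<inter> shift s K = {s}"
      using iso[of s] s unfolding isolated_def by blast
    have U: "is_subgroup (K \<inter> W)" using is_subgroup_Int K(1) W(1) by blast
    have "card (K \<inter> W) \<ge> 3"
    proof (cases "K \<subseteq> W")
      case True
      then have "K \<inter> W = K" by blast
      then show ?thesis using K(3) by simp
    next
      case False
      then show ?thesis using index2_Int[OF subgroup_G W(1,2) W2 K(1,2)] K(3) by simp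
    qed
    moreover have "B \<inter> shift s (K \<inter> W) = {s}"
    proof -
      have "s \<in> shift s (K \<inter> W)" using is_subgroup_0[OF U] by simp
      moreover have "shift s (K \<inter> W) \<subseteq> shift s K" by (simp add: subset_iff)
      ultimately show ?thesis using K(4) s by blast
    qed
    ultimately have "s \<in> triple_sums (shift s W - B)" using flat_triple[OF U, of W s] s by blast
    then show "s \<in> triple_sums Z - Z" using oc(4)[OF s] s unfolding Z_def by auto
  qed
  have "card (B - Q) = 16 - card Q" using card_Diff_subset[OF finQ QB] c by simp
  moreover have "card (B - Q) \<le> card (triple_sums Z - Z)"
    using CZ card_triple_sums(1)[OF oc(2)] by (intro card_mono) auto
  moreover have "card (triple_sums Z - Z) \<le> card Z choose 3"
    using card_triple_sums(2)[OF oc(2)] card_mono[OF card_triple_sums(1)[OF oc(2)] Diff_subset, of Z] by linarith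
  ultimately have t: "card (triple_sums Z - Z) \<ge> 16 - card Q" "16 - card Q \<le> card Q choose 3" using cZ by simp_all
  have "card Q \<in> {0, 1, 2, 3, 4, 5, 6}" using cZ(2) by auto
  \<comment> \<open>The inequality fails for all smaller sizes, most narrowly for five points: 11 >
    10.\<close>
  then have Q6: "card Q = 6" using t(2) by (auto simp: eval_nat_numeral)
  have t7: "card (triple_sums Z - Z) \<ge> 7" using t(1) Q6 by simp
  have Z6: "card Z = 6" using cZ Q6 by simp
  have c16: "card W = 2 ^ 4" using W(3) by simp
  have Qs: "Q \<subseteq> shift r W" unfolding Q_def by blast
  have c6: "card Q \<ge> 4 + 2" using Q6 by simp
  obtain X where X: "X \<subseteq> Q" "X \<noteq> {}" "even (card X)" "\<Sum>X = 0"
    by (rule even_zero_sum[OF W(1) c16 finQ Qs c6])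
  have finX: "finite X" using X(1) finQ finite_subset by blast
  have X4: "card X \<ge> 4" using zero_sum_even_ge[OF X(4,3) finX X(2)] .
  have flat: "\<exists>U p. is_subgroup U \<and> U \<subseteq> W \<and> card U = 4 \<and> shift p U \<subseteq> Z \<and> B \<inter> shift x U = {x}" if x: "x \<in> X" for x
  proof -
    have xQ: "x \<in> Q" "x \<in> B" using x X(1) QB by blast+
    obtain K where K: "is_subgroup K" "K \<subseteq> G" "card K = 8" "B \<inter> shift x K = {x}"
      using iso[OF xQ(2)] unfolding isolated_def by blast
    have "r + x \<in> W" using xQ(1) by (simp add: Q_def)
    then have xW: "shift x W = shift r W" using shift_eq[OF W(1), of r x] by simp
    have nW: "\<not> K \<subseteq> W"
    proof
      assume KW: "K \<subseteq> W"
      have 2: "card W = 2 * card K" using K(3) W(3) by simp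
      have Xs: "X \<subseteq> shift x W" unfolding xW using X(1) Qs by blast
      have "X \<inter> shift x K = {x}" using K(4) x X(1) QB by blast
      from separated_zero_sum[OF W(1) K(1) KW 2 finX Xs this X(3,4)] show False .
    qed
    obtain U p where "is_subgroup U" "U \<subseteq> W" "card U = 4" "shift p U \<subseteq> shift a G - shift x W - B" "B \<inter> shift x U = {x}"
      by (rule isolated_split[OF W(1,2) W2 xQ(2) K nW])
    then show ?thesis unfolding xW Z_def[symmetric] by blast
  qed
  obtain x0 where x0: "x0 \<in> X" using X(2) by blast
  obtain U p where U: "is_subgroup U" "U \<subseteq> W" "card U = 4" "shift p U \<subseteq> Z" using flat[OF x0] by blast
  have alone: "x + y \<notin> U" if xy: "x \<in> X" "y \<in> Q" "x \<noteq> y" for x y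
  proof -
    obtain U' p' where U': "is_subgroup U'" "card U' = 4" "shift p' U' \<subseteq> Z" "B \<inter> shift x U' = {x}"
      using flat[OF xy(1)] by blast
    have e: "U' = U" by (rule flat_unique[OF U(1,3,4) U'(1-3) Z6 t7])
    have "y \<in> B" using xy(2) QB by blast
    then have "y \<notin> shift x U'" using Int_singletonD[OF U'(4)] xy(3) by metis
    then show ?thesis using e by simp
  qed
  \<comment> \<open>One point q outside X may be added because \<open>alone\<close> requires only
    one of the two points to lie in X.\<close>
  have pack: "card Y \<le> 4" if "Y \<subseteq> insert q X" "q \<in> Q" for Y q
  proof -
    have "card Y * card U \<le> card W"
    proof (rule card_packing[OF W(1) U(1,2)])
      show "Y \<subseteq> shift r W" using that X(1) Qs by blast
      fix x y assume "x \<in> Y" "y \<in> Y" "x \<noteq> y"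
      then show "x + y \<notin> U"
        using that X(1) alone[of x y] alone[of y x] by (auto simp: add.commute)
    qed
    then show ?thesis using U(3) W(3) by simp
  qed
  have "card X \<le> 4" using pack[of X x0] x0 X(1) by blast
  then have "X \<noteq> Q" using Q6 by auto
  then obtain q where q: "q \<in> Q" "q \<notin> X" using X(1) by blast
  then show False using pack[of "insert q X" q] X4 finX by simp
qed

theorem card_R_le: "card R \<le> 124"
proof (cases "\<exists>r\<in>B. \<exists>M. is_subgroup M \<and> M \<subseteq> G \<and> card G = 2 * card M \<and> B \<inter> shift r M = {r}")
  case True
  then show ?thesis using isolated_hyperplane_bound by blast
next
  case no: False
  have big: "card (A r) \<le> 10 \<and> card B \<le> 11" if "r \<in> B" "card (A r) \<ge> 9" for r
    using big_fiber[OF that] no that(1) by blast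
  have sum_le: "card R \<le> card B * k" if "\<And>r. r \<in> B \<Longrightarrow> card (A r) \<le> k" for k
    unfolding card_R using sum_bounded_above[of B "\<lambda>r. card (A r)" k] that by simp
  show ?thesis
  proof (cases "\<exists>r\<in>B. card (A r) \<ge> 9")
    case True
    have "card (A r) \<le> 10" if "r \<in> B" for r using big[OF that] by linarith
    then have "card R \<le> card B * 10" by (rule sum_le)
    moreover have "card B \<le> 11" using True big by blast
    ultimately show ?thesis by linarith
  next
    case False
    have le8: "card (A r) \<le> 8" if "r \<in> B" for r
    proof -
      have "\<not> card (A r) \<ge> 9" using False that by blast
      then show ?thesis by simp
    qed
    show ?thesis
    proof (cases "card B \<le> 15")
      case True
      have "card R \<le> card B * 8" using le8 by (rule sum_le)
      then show ?thesis using True by simp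
    next
      case B16: False
      show ?thesis
      proof (cases "\<exists>r\<in>B. card (A r) \<ge> 5 \<and> \<not> isolated r")
        case True
        then obtain r where r: "r \<in> B" "card (A r) \<ge> 5" "\<not> isolated r" by blast
        obtain W where W: "is_subgroup W" "W \<subseteq> G" "card W = 16" "card (B \<inter> shift r W) = 6" "\<Sum>(B \<inter> shift r W) = 0"
          by (rule hexad[OF r])
        show ?thesis by (rule hexad_bound[OF le8 _ W(1-3) r(1) W(4,5)]) (use B16 in auto)
      next
        case iso: False
        define T where "T = {r\<in>B. isolated r}"
        define Z where "Z = shift a G - B"
        have TB: "T \<subseteq> B" by (auto simp: T_def)
        have lo: "card (A r) \<le> 4" if "r \<in> B - T" for r
        proof -
          have "\<not> card (A r) \<ge> 5" using iso that unfolding T_def by blast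
          then show ?thesis by simp
        qed
        have hi: "card (A r) \<le> 4 + 4" if "r \<in> T" for r
          using le8[OF subsetD[OF TB that]] by simp
        have total: "card R \<le> 4 * card B + 4 * card T"
          unfolding card_R by (rule sum_le_two_level[OF finite_B TB lo hi])
        have "\<forall>r. \<exists>H. r \<in> T \<longrightarrow> is_subgroup H \<and> H \<subseteq> G \<and> card H = 8 \<and> B \<inter> shift r H = {r}"
          unfolding T_def isolated_def by blast
        then obtain H where H: "\<And>r. r \<in> T \<Longrightarrow> is_subgroup (H r) \<and> H r \<subseteq> G \<and> card (H r) = 8 \<and> B \<inter> shift r (H r) = {r}"
          by metis
        have cT: "card T \<le> card Z" by (rule oddtown_flats(1)[OF subgroup_G card_G TB B_sub Z_def H])
        have cZ: "card Z = 32 - card B" "card B \<le> 32"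
          unfolding Z_def using card_Diff_subset[OF finite_B B_sub] card_G card_B_le by simp_all
        show ?thesis
        \<comment> \<open>By \<open>total\<close>, a sum of 31 gives 4 * 31 = 124. Oddtown bounds
          the sum by 32, so only equality remains.\<close>
        proof (cases "card T + card B \<le> 31")
          case True
          then show ?thesis using total by linarith
        next
          case False
          then have c: "card T = card Z" using cT cZ by linarith
          from oddtown_flats_eq[OF subgroup_G card_G TB B_sub Z_def H c] show ?thesis
          proof
            assume "T \<union> Z = {}"
            then have "B = shift a G" using B_sub unfolding Z_def by blast
            then show ?thesis using card_le_full card_G by simp
          next
            assume eq: "T = B"
            have "card B = 32 - card B" using c cZ(1) unfolding eq by simp
            then have "card B = 16" using cZ(2) by linarith
            then show ?thesis using not_all_isolated eq unfolding T_def by blast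
          qed
        qed
      qed
    qed
  qed
qed

end

lemma config_bound5: "config G a b R \<Longrightarrow> card G = 32 \<Longrightarrow> card R \<le> 124"
  using config5.card_R_le by (metis config5.intro config5_axioms.intro)

section \<open>The groups \<open>Z_4^n\<close>\<close>

instance bit :: boolean_group
proof
  fix x :: bit
  show "x + x = 0" by (cases x) simp_all
qed

instance "fun" :: (type, boolean_group) boolean_group
  by standard (simp add: fun_eq_iff)

text \<open>Functions that vanish from n on, so that one type with pointwise addition serves all
  n.\<close>

definition bitvecs :: "nat \<Rightarrow> (nat \<Rightarrow> bit) set" where
  "bitvecs n = {f. \<forall>i\<ge>n. f i = 0}"

lemma bitvecs_Suc:
  defines "e n \<equiv> \<lambda>i. if i = n then 1 else 0 :: bit"
  shows "bitvecs (Suc n) = bitvecs n \<union> shift (e n) (bitvecs n)"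
proof (rule Set.set_eqI)
  fix f :: "nat \<Rightarrow> bit"
  have from_n: "(\<forall>i\<ge>n. P i) \<longleftrightarrow> P n \<and> (\<forall>i\<ge>Suc n. P i)" for P
  proof
    assume *: "P n \<and> (\<forall>i\<ge>Suc n. P i)"
    show "\<forall>i\<ge>n. P i"
    proof (intro allI impI)
      fix i assume "n \<le> i"
      then consider "i = n" | "Suc n \<le> i" by linarith
      then show "P i" using * by cases auto
    qed
  qed simp
  have "(\<forall>i\<ge>Suc n. e n i + f i = 0) \<longleftrightarrow> (\<forall>i\<ge>Suc n. f i = 0)" by (simp add: e_def)
  moreover have "f n = 0 \<or> e n n + f n = 0" by (cases "f n") (simp_all add: e_def)
  ultimately have "(\<forall>i\<ge>Suc n. f i = 0) \<longleftrightarrow> (\<forall>i\<ge>n. f i = 0) \<or> (\<forall>i\<ge>n. e n i + f i = 0)"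
    unfolding from_n[of "\<lambda>i. f i = 0"] from_n[of "\<lambda>i. e n i + f i = 0"] by blast
  then show "f \<in> bitvecs (Suc n) \<longleftrightarrow> f \<in> bitvecs n \<union> shift (e n) (bitvecs n)"
    by (simp only: bitvecs_def mem_shift Un_iff mem_Collect_eq plus_fun_apply)
qed

lemma bitvecs_subgroup: "is_subgroup (bitvecs n)" "card (bitvecs n) = 2 ^ n"
proof -
  have "is_subgroup (bitvecs n) \<and> card (bitvecs n) = 2 ^ n"
  proof (induction n)
    case 0
    have "bitvecs 0 = {0}" unfolding bitvecs_def by (auto simp: fun_eq_iff)
    moreover have "is_subgroup {0 :: nat \<Rightarrow> bit}" by (rule is_subgroupI) simp_all
    ultimately show ?case by simp
  next
    case (Suc n)
    let ?e = "\<lambda>i. if i = n then 1 else 0 :: bit"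
    have "?e \<notin> bitvecs n" unfolding bitvecs_def by auto
    from is_subgroup_extend[OF conjunct1[OF Suc] this] show ?case
      unfolding bitvecs_Suc using conjunct2[OF Suc] by simp
  qed
  then show "is_subgroup (bitvecs n)" "card (bitvecs n) = 2 ^ n" by blast+
qed

section \<open>Binary digits in Z_4^n\<close>

abbreviation (input) Z4 :: "nat \<Rightarrow> (nat \<Rightarrow> int) monoid" where
  "Z4 n \<equiv> Zmod_power 4 n"

lemma carrier_Z4: "carrier (Z4 n) = {..<n} \<rightarrow>\<^sub>E {0..<4}"
  by (simp add: Zmod_power_def carrier_integer_mod_group)

lemma mult_Z4: "x \<otimes>\<^bsub>Z4 n\<^esub> y = (\<lambda>i\<in>{..<n}. (x i + y i) mod 4)"
  by (simp add: Zmod_power_def)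

lemma group_Z4: "group (Z4 n)"
  by (simp add: Zmod_power_def)

text \<open>The default 0 lands in \<open>bitvecs n\<close>; elements of the carrier are
  \<open>undefined\<close> from n on.\<close>

definition parity :: "nat \<Rightarrow> (nat \<Rightarrow> int) \<Rightarrow> nat \<Rightarrow> bit" where
  "parity n x = (\<lambda>i. if i < n then of_int (x i) else 0)"

definition half :: "nat \<Rightarrow> (nat \<Rightarrow> int) \<Rightarrow> nat \<Rightarrow> bit" where
  "half n x = (\<lambda>i. if i < n then of_int (x i div 2) else 0)"

definition split4 :: "nat \<Rightarrow> (nat \<Rightarrow> int) \<Rightarrow> (nat \<Rightarrow> bit) \<times> (nat \<Rightarrow> bit)" where
  "split4 n x = (parity n x, half n x)"

lemma of_int_bit: "(of_int k :: bit) = of_bool (odd k)"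
proof (cases "even k")
  case True
  then obtain l where "k = 2 * l" by (rule evenE)
  then show ?thesis by simp
next
  case False
  then obtain l where "k = 2 * l + 1" by (rule oddE)
  then show ?thesis by simp
qed

lemma of_bool_bit_eq: "of_bool p = (of_bool q :: bit) \<longleftrightarrow> p = q"
  by (cases p; cases q) simp_all

lemma of_bool_bit_add: "of_bool p + of_bool q = (of_bool (p \<noteq> q) :: bit)"
  by (cases p; cases q) simp_all

lemma inj_on_split4: "inj_on (split4 n) (carrier (Z4 n))"
proof (rule inj_onI)
  fix x y assume x: "x \<in> carrier (Z4 n)" and y: "y \<in> carrier (Z4 n)" and eq: "split4 n x = split4 n y"
  have xy: "x i = y i" if i: "i < n" for i
  proof -
    have "parity n x i = parity n y i" "half n x i = half n y i" using eq by (simp_all add: split4_def)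
    then have "odd (x i) = odd (y i)" "odd (x i div 2) = odd (y i div 2)"
      using i by (simp_all add: parity_def half_def of_int_bit of_bool_bit_eq)
    moreover have "x i \<in> {0..<4}" "y i \<in> {0..<4}" using PiE_mem[OF x[unfolded carrier_Z4], of i] PiE_mem[OF y[unfolded carrier_Z4], of i] i
      by simp_all
    then have "0 \<le> x i" "x i < 4" "0 \<le> y i" "y i < 4" by simp_all
    ultimately show ?thesis by presburger
  qed
  show "x = y"
    by (rule PiE_ext[OF x[unfolded carrier_Z4] y[unfolded carrier_Z4]]) (simp add: xy)
qed

lemma bij_betw_split4: "bij_betw (split4 n) (carrier (Z4 n)) (bitvecs n \<times> bitvecs n)"
proof -
  have sub: "split4 n ` carrier (Z4 n) \<subseteq> bitvecs n \<times> bitvecs n"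
    by (rule image_subsetI) (simp add: split4_def parity_def half_def bitvecs_def)
  have "card (split4 n ` carrier (Z4 n)) = 4 ^ n"
    using card_image[OF inj_on_split4] by (simp add: carrier_Z4 card_PiE)
  also have "\<dots> = card (bitvecs n \<times> bitvecs n)"
    by (simp add: card_cartesian_product bitvecs_subgroup(2) power_mult_distrib[symmetric])
  finally have c: "card (split4 n ` carrier (Z4 n)) = card (bitvecs n \<times> bitvecs n)" .
  have "finite (bitvecs n \<times> bitvecs n)" using is_subgroup_finite[OF bitvecs_subgroup(1)] by simp
  from card_subset_eq[OF this sub c] have "split4 n ` carrier (Z4 n) = bitvecs n \<times> bitvecs n" .
  then show ?thesis using inj_on_split4 by (simp add: bij_betw_def)
qed

text \<open>Carries keep \<open>half\<close> from being additive, but 2d has even coordinates, so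
  adding it keeps the parity and adds the parity of d to the half.\<close>

lemma split4_mult:
  shows "parity n (x \<otimes>\<^bsub>Z4 n\<^esub> d) = parity n x + parity n d"
    and "split4 n (x \<otimes>\<^bsub>Z4 n\<^esub> (d \<otimes>\<^bsub>Z4 n\<^esub> d)) = (parity n x, half n x + parity n d)"
proof -
  have 1: "odd ((x i + d i) mod 4) \<longleftrightarrow> odd (x i) \<noteq> odd (d i)" for i
    by presburger
  show "parity n (x \<otimes>\<^bsub>Z4 n\<^esub> d) = parity n x + parity n d"
    by (rule ext) (auto simp: parity_def mult_Z4 of_int_bit of_bool_bit_add of_bool_bit_eq 1)
  have 2: "odd ((x i + 2 * d i mod 4) mod 4) \<longleftrightarrow> odd (x i)" for i
    by presburger
  have 3: "odd ((x i + 2 * d i mod 4) mod 4 div 2) \<longleftrightarrow> odd (x i div 2) \<noteq> odd (d i)" for i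
    by presburger
  have "parity n (x \<otimes>\<^bsub>Z4 n\<^esub> (d \<otimes>\<^bsub>Z4 n\<^esub> d)) = parity n x"
    by (rule ext) (auto simp: parity_def mult_Z4 of_int_bit of_bool_bit_eq 2)
  moreover have "half n (x \<otimes>\<^bsub>Z4 n\<^esub> (d \<otimes>\<^bsub>Z4 n\<^esub> d)) = half n x + parity n d"
    by (rule ext) (auto simp: parity_def half_def mult_Z4 of_int_bit of_bool_bit_add of_bool_bit_eq 3)
  ultimately show "split4 n (x \<otimes>\<^bsub>Z4 n\<^esub> (d \<otimes>\<^bsub>Z4 n\<^esub> d)) = (parity n x, half n x + parity n d)"
    by (simp add: split4_def)
qed

lemma (in group) proper_AP_3:
  "proper_AP G 3 xs \<longleftrightarrow> (\<exists>x\<in>carrier G. \<exists>d\<in>carrier G. xs = [x, x \<otimes> d, x \<otimes> (d \<otimes> d)]) \<and> distinct xs"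
proof -
  have "map (\<lambda>i. x \<otimes> d [^] i) [0..<3] = [x, x \<otimes> d, x \<otimes> (d \<otimes> d)]"
    if "x \<in> carrier G" "d \<in> carrier G" for x d
    using that by (simp add: numeral_3_eq_3 upt_rec)
  then show ?thesis unfolding proper_AP_def by metis
qed

text \<open>For ends x, z of parity r with halves u, v, every y of parity r + (u + v) is a middle
  term: d = y - x satisfies 2d = z - x whatever the half of y is.\<close>

lemma AP_free_Z4_iff:
  assumes S: "S \<subseteq> carrier (Z4 n)"
  shows "AP_free (Z4 n) 3 S \<longleftrightarrow> fiberwise_AP_free (split4 n ` S)"
proof -
  interpret group "Z4 n" by (rule group_Z4)
  show ?thesis
  proof
    assume free: "AP_free (Z4 n) 3 S"
    show "fiberwise_AP_free (split4 n ` S)"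
      unfolding fiberwise_AP_free_def
    proof (intro allI impI notI)
      fix r u v assume "(r, u) \<in> split4 n ` S" "(r, v) \<in> split4 n ` S" "u \<noteq> v"
        and "r + (u + v) \<in> Domain (split4 n ` S)"
      then obtain x y z where xyz: "x \<in> S" "y \<in> S" "z \<in> S" "split4 n x = (r, u)" "split4 n z = (r, v)"
        "parity n y = r + (u + v)" by (auto simp: split4_def)
      have c: "x \<in> carrier (Z4 n)" "y \<in> carrier (Z4 n)" "z \<in> carrier (Z4 n)" using xyz S by auto
      define d where "d = inv\<^bsub>Z4 n\<^esub> x \<otimes>\<^bsub>Z4 n\<^esub> y"
      have d: "d \<in> carrier (Z4 n)" "x \<otimes>\<^bsub>Z4 n\<^esub> d = y" using c by (simp_all add: d_def m_assoc[symmetric])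
      have "parity n x = r" "half n x = u" using xyz(4) by (simp_all add: split4_def)
      moreover from this have "r + parity n d = r + (u + v)"
        using split4_mult(1)[of n x d] d(2) xyz(6) by simp
      then have pd: "parity n d = u + v" by simp
      ultimately have "split4 n (x \<otimes>\<^bsub>Z4 n\<^esub> (d \<otimes>\<^bsub>Z4 n\<^esub> d)) = split4 n z"
        using split4_mult(2)[of n x d] xyz(5) by simp
      then have "x \<otimes>\<^bsub>Z4 n\<^esub> (d \<otimes>\<^bsub>Z4 n\<^esub> d) = z" using inj_on_split4 c d(1) by (auto dest: inj_onD)
      moreover have "x \<noteq> z" using xyz(4,5) \<open>u \<noteq> v\<close> by auto
      moreover have "parity n y \<noteq> r" using xyz(6) \<open>u \<noteq> v\<close> by simp
      then have "x \<noteq> y" "y \<noteq> z" using xyz(4,5) by (auto simp: split4_def)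
      ultimately have "proper_AP (Z4 n) 3 [x, y, z]"
        unfolding proper_AP_3 using c(1) d by auto
      then show False using free xyz(1-3) unfolding AP_free_def by (metis empty_set insert_subset list.simps(15) empty_subsetI)
    qed
  next
    assume fiberwise_AP_free: "fiberwise_AP_free (split4 n ` S)"
    show "AP_free (Z4 n) 3 S"
      unfolding AP_free_def
    proof (intro conjI S notI)
      assume "\<exists>xs. proper_AP (Z4 n) 3 xs \<and> set xs \<subseteq> S"
      then obtain x d where xd: "x \<in> carrier (Z4 n)" "d \<in> carrier (Z4 n)"
        and dist: "distinct [x, x \<otimes>\<^bsub>Z4 n\<^esub> d, x \<otimes>\<^bsub>Z4 n\<^esub> (d \<otimes>\<^bsub>Z4 n\<^esub> d)]"
        and sub: "set [x, x \<otimes>\<^bsub>Z4 n\<^esub> d, x \<otimes>\<^bsub>Z4 n\<^esub> (d \<otimes>\<^bsub>Z4 n\<^esub> d)] \<subseteq> S"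
        unfolding proper_AP_3 by metis
      let ?z = "x \<otimes>\<^bsub>Z4 n\<^esub> (d \<otimes>\<^bsub>Z4 n\<^esub> d)"
      have z: "split4 n ?z = (parity n x, half n x + parity n d)" by (rule split4_mult(2))
      have "split4 n ?z \<noteq> split4 n x"
        using dist xd inj_on_split4[of n] by (auto dest: inj_onD)
      then have ne: "half n x \<noteq> half n x + parity n d" unfolding z by (simp add: split4_def)
      have "split4 n x \<in> split4 n ` S" "split4 n ?z \<in> split4 n ` S" using sub by simp_all
      then have "(parity n x, half n x) \<in> split4 n ` S" "(parity n x, half n x + parity n d) \<in> split4 n ` S"
        unfolding z by (simp_all add: split4_def)
      then have "parity n x + (half n x + (half n x + parity n d)) \<notin> Domain (split4 n ` S)"
        using fiberwise_AP_free ne unfolding fiberwise_AP_free_def by blast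
      moreover have "split4 n (x \<otimes>\<^bsub>Z4 n\<^esub> d) \<in> split4 n ` S" using sub by simp
      then have "parity n x + parity n d \<in> Domain (split4 n ` S)"
        unfolding split4_def[of n "x \<otimes>\<^bsub>Z4 n\<^esub> d"] split4_mult(1) by (rule DomainI)
      ultimately show False by simp
    qed
  qed
qed

lemma max_AP_free_Z4:
  assumes upper: "\<And>a b (R :: ((nat \<Rightarrow> bit) \<times> (nat \<Rightarrow> bit)) set). config (bitvecs n) a b R \<Longrightarrow> card R \<le> c"
    and R: "R \<subseteq> bitvecs n \<times> bitvecs n" "fiberwise_AP_free R" "card R = c"
  shows "max_AP_free 3 (Z4 n) = c"
  unfolding max_AP_free_def
proof (rule Max_eqI)
  have im: "split4 n ` carrier (Z4 n) = bitvecs n \<times> bitvecs n"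
    using bij_betw_split4 by (simp add: bij_betw_def)
  have fin: "finite (carrier (Z4 n))" by (rule finite_carrier_Zmod_power) simp
  have "{card S |S. AP_free (Z4 n) 3 S} \<subseteq> card ` Pow (carrier (Z4 n))" unfolding AP_free_def by blast
  then show "finite {card S |S. AP_free (Z4 n) 3 S}" by (rule finite_subset) (simp add: fin)
  show "k \<le> c" if k: "k \<in> {card S |S. AP_free (Z4 n) 3 S}" for k
  proof -
    obtain S where S: "k = card S" "AP_free (Z4 n) 3 S" using k by blast
    have sub: "S \<subseteq> carrier (Z4 n)" using S(2) by (simp add: AP_free_def)
    have "shift 0 (bitvecs n) = bitvecs n" by (simp add: shift_def)
    moreover have "split4 n ` S \<subseteq> bitvecs n \<times> bitvecs n" using image_mono[OF sub, of "split4 n"] unfolding im .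
    moreover have "fiberwise_AP_free (split4 n ` S)" using S(2) AP_free_Z4_iff[OF sub] by simp
    ultimately have "config (bitvecs n) 0 0 (split4 n ` S)"
      by (intro config.intro bitvecs_subgroup(1)) simp_all
    then have "card (split4 n ` S) \<le> c" by (rule upper)
    then show ?thesis unfolding S(1) card_image[OF inj_on_subset[OF inj_on_split4 sub]] .
  qed
  let ?S = "{x \<in> carrier (Z4 n). split4 n x \<in> R}"
  have sub: "?S \<subseteq> carrier (Z4 n)" by simp
  have imR: "split4 n ` ?S = R"
  proof
    show "split4 n ` ?S \<subseteq> R" by (rule image_subsetI) simp
    show "R \<subseteq> split4 n ` ?S"
    proof
      fix p assume p: "p \<in> R"
      then have "p \<in> split4 n ` carrier (Z4 n)" unfolding im by (rule subsetD[OF R(1)])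
      then obtain x where "p = split4 n x" "x \<in> carrier (Z4 n)" by (rule imageE)
      then show "p \<in> split4 n ` ?S" using p by (intro image_eqI[of _ _ x]) simp_all
    qed
  qed
  have "card ?S = c"
    using card_image[OF inj_on_subset[OF inj_on_split4 sub]] unfolding imR R(3) by (rule sym)
  moreover have "AP_free (Z4 n) 3 ?S" unfolding AP_free_Z4_iff[OF sub] imR by (rule R(2))
  ultimately show "c \<in> {card S |S. AP_free (Z4 n) 3 S}" by blast
qed

section \<open>Progression-free sets of maximal size\<close>

definition bitvec :: "nat \<Rightarrow> nat \<Rightarrow> bit" where
  "bitvec k = (\<lambda>i. of_bool (bit k i))"

text \<open>Coding vectors by numbers turns addition into \<open>xor\<close>, so that the examples
  can be checked by evaluation.\<close>

lemma bitvec_xor: "bitvec k + bitvec l = bitvec (xor k l)"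
  by (auto simp: bitvec_def fun_eq_iff bit_xor_iff)

lemma inj_bitvec: "inj bitvec"
  by (rule injI, rule bit_eqI) (simp add: bitvec_def fun_eq_iff of_bool_bit_eq)

lemma bitvec_in_bitvecs: "k < 2 ^ n \<Longrightarrow> bitvec k \<in> bitvecs n"
  unfolding bitvecs_def bitvec_def
  by (auto simp: bit_iff_odd) (metis div_less dvd_0_right less_le_trans one_le_numeral power_increasing)

definition decode :: "(nat \<times> nat list) list \<Rightarrow> ((nat \<Rightarrow> bit) \<times> (nat \<Rightarrow> bit)) set" where
  "decode L = (\<Union>(r, us)\<in>set L. {bitvec r} \<times> bitvec ` set us)"

definition valid :: "nat \<Rightarrow> (nat \<times> nat list) list \<Rightarrow> bool" where
  "valid n L \<longleftrightarrow> distinct (map fst L) \<and>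
     (\<forall>(r, us)\<in>set L. r < 2 ^ n \<and> distinct us \<and> (\<forall>u\<in>set us. u < 2 ^ n) \<and>
       (\<forall>u\<in>set us. \<forall>v\<in>set us. u = v \<or> xor r (xor u v) \<notin> fst ` set L))"

lemma mem_decode:
  "(x, y) \<in> decode L \<longleftrightarrow> (\<exists>r us u. (r, us) \<in> set L \<and> u \<in> set us \<and> x = bitvec r \<and> y = bitvec u)"
  unfolding decode_def by force

lemma card_decode:
  "distinct (map fst L) \<Longrightarrow> (\<And>r us. (r, us) \<in> set L \<Longrightarrow> distinct us) \<Longrightarrow>
    finite (decode L) \<and> card (decode L) = (\<Sum>(r, us)\<leftarrow>L. length us)"
proof (induction L)
  case Nil
  then show ?case by (simp add: decode_def)
next
  case (Cons p L)
  obtain r us where p: "p = (r, us)" by (cases p)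
  let ?X = "{bitvec r} \<times> bitvec ` set us"
  have IH: "finite (decode L)" "card (decode L) = (\<Sum>(r, us)\<leftarrow>L. length us)"
    using Cons.IH Cons.prems(1) Cons.prems(2)[OF list.set_intros(2)] by simp_all
  have "distinct us" using Cons.prems(2)[of r us] by (simp add: p)
  then have "card ?X = length us"
    by (simp add: card_cartesian_product card_image[OF inj_on_subset[OF inj_bitvec]] distinct_card)
  moreover have "decode (p # L) = ?X \<union> decode L" by (simp add: decode_def p)
  moreover have "?X \<inter> decode L = {}"
  proof (rule ccontr)
    assume "\<not> ?thesis"
    then obtain y where "(bitvec r, y) \<in> decode L" by blast
    then obtain r' vs where "(r', vs) \<in> set L" "bitvec r = bitvec r'" unfolding mem_decode by blast
    then have "(r, vs) \<in> set L" using injD[OF inj_bitvec, of r r'] by simp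
    then have "r \<in> fst ` set L" by (metis fst_conv image_eqI)
    then show False using Cons.prems(1) by (simp add: p)
  qed
  ultimately show ?case using IH card_Un_disjoint[of ?X "decode L"] by (simp add: p)
qed

lemma decode_valid:
  assumes "valid n L"
  shows "decode L \<subseteq> bitvecs n \<times> bitvecs n" "fiberwise_AP_free (decode L)"
    "card (decode L) = (\<Sum>(r, us)\<leftarrow>L. length us)"
proof -
  have dist: "distinct (map fst L)" using assms by (simp add: valid_def)
  have L: "r < 2 ^ n \<and> distinct us \<and> (\<forall>u\<in>set us. u < 2 ^ n) \<and>
      (\<forall>u\<in>set us. \<forall>v\<in>set us. u = v \<or> xor r (xor u v) \<notin> fst ` set L)" if "(r, us) \<in> set L" for r us
    using bspec[OF conjunct2[OF assms[unfolded valid_def]] that] by simp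
  show "decode L \<subseteq> bitvecs n \<times> bitvecs n"
  proof (rule subrelI)
    fix x y assume "(x, y) \<in> decode L"
    then obtain r us u where 1: "(r, us) \<in> set L" "u \<in> set us" "x = bitvec r" "y = bitvec u"
      unfolding mem_decode by blast
    show "(x, y) \<in> bitvecs n \<times> bitvecs n"
      using L[OF 1(1)] 1(2) bitvec_in_bitvecs unfolding 1(3,4) by simp
  qed
  show "fiberwise_AP_free (decode L)"
    unfolding fiberwise_AP_free_def
  proof (intro allI impI notI)
    fix x y z assume *: "(x, y) \<in> decode L" "(x, z) \<in> decode L" "y \<noteq> z" "x + (y + z) \<in> Domain (decode L)"
    obtain r us u where 1: "(r, us) \<in> set L" "u \<in> set us" "x = bitvec r" "y = bitvec u"
      using *(1) unfolding mem_decode by blast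
    obtain r' vs v where 2: "(r', vs) \<in> set L" "v \<in> set vs" "x = bitvec r'" "z = bitvec v"
      using *(2) unfolding mem_decode by blast
    have "r' = r" using injD[OF inj_bitvec, of r' r] 1(3) 2(3) by simp
    then have "vs = us" using eq_key_imp_eq_value[OF dist] 1(1) 2(1) by blast
    have "u \<noteq> v" using *(3) 1(4) 2(4) by blast
    obtain s ws where s: "(s, ws) \<in> set L" "x + (y + z) = bitvec s"
      using *(4) unfolding Domain_iff mem_decode by blast
    then have "bitvec (xor r (xor u v)) = bitvec s" by (simp add: 1(3,4) 2(4) bitvec_xor)
    then have "xor r (xor u v) = s" by (rule injD[OF inj_bitvec])
    then have "xor r (xor u v) \<in> fst ` set L" using s(1) by (metis fst_conv image_eqI)
    then show False using L[OF 1(1)] 1(2) 2(2) \<open>vs = us\<close> \<open>u \<noteq> v\<close> by blast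
  qed
  show "card (decode L) = (\<Sum>(r, us)\<leftarrow>L. length us)"
    using card_decode[OF dist] L by blast
qed

lemma max_AP_free_Z4_witness:
  assumes "\<And>G a b (R :: ((nat \<Rightarrow> bit) \<times> (nat \<Rightarrow> bit)) set). config G a b R \<Longrightarrow> card G = 2 ^ n \<Longrightarrow> card R \<le> c"
    and "valid n L" "(\<Sum>(r, us)\<leftarrow>L. length us) = c"
  shows "max_AP_free 3 (Z4 n) = c"
proof (rule max_AP_free_Z4)
  show "card R \<le> c" if "config (bitvecs n) a b R" for a b and R :: "((nat \<Rightarrow> bit) \<times> (nat \<Rightarrow> bit)) set"
    by (rule assms(1)[OF that bitvecs_subgroup(2)])
qed (use decode_valid[OF assms(2)] assms(3) in simp_all)

text \<open>The first components are the vectors of weight at most 2, each fiber is a subgroup, and its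
  translate by \<open>r\<close> contains no other vector of weight at most 2.\<close>

definition witness4 :: "(nat \<times> nat list) list" where
  "witness4 = [(0, [0, 15]), (1, [0, 6, 10, 12]), (2, [0, 5, 9, 12]), (3, [0, 4, 8, 12]),
     (4, [0, 3, 9, 10]), (5, [0, 2, 8, 10]), (6, [0, 1, 8, 9]), (8, [0, 3, 5, 6]),
     (9, [0, 2, 4, 6]), (10, [0, 1, 4, 5]), (12, [0, 1, 2, 3])]"

definition witness5 :: "(nat \<times> nat list) list" where
  "witness5 = [(0, [0, 7, 28, 27]), (1, [0, 6, 10, 12, 18, 20, 24, 30]),
     (2, [0, 5, 9, 12, 17, 20, 24, 29]), (3, [0, 4, 8, 12, 16, 20, 24, 28]),
     (4, [0, 3, 9, 10, 17, 18, 24, 27]), (5, [0, 2, 8, 10, 16, 18, 24, 26]),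
     (6, [0, 1, 8, 9, 16, 17, 24, 25]), (8, [0, 3, 5, 6, 17, 18, 20, 23]),
     (9, [0, 2, 4, 6, 16, 18, 20, 22]), (10, [0, 1, 4, 5, 16, 17, 20, 21]),
     (12, [0, 1, 2, 3, 16, 17, 18, 19]), (16, [0, 3, 5, 6, 9, 10, 12, 15]),
     (17, [0, 2, 4, 6, 8, 10, 12, 14]), (18, [0, 1, 4, 5, 8, 9, 12, 13]),
     (20, [0, 1, 2, 3, 8, 9, 10, 11]), (24, [0, 1, 2, 3, 4, 5, 6, 7])]"

lemma valid_witness4: "valid 4 witness4"
  by (simp add: valid_def witness4_def numeral_3_eq_3[symmetric])

lemma valid_witness5: "valid 5 witness5"
  by (simp add: valid_def witness5_def numeral_3_eq_3[symmetric])

theorem theorem3p1: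
  "max_AP_free 3 (Zmod_power 4 1) = 2 \<and>
   max_AP_free 3 (Zmod_power 4 2) = 6 \<and>
   max_AP_free 3 (Zmod_power 4 3) = 16 \<and>
   max_AP_free 3 (Zmod_power 4 4) = 42 \<and>
   max_AP_free 3 (Zmod_power 4 5) = 124"
proof (intro conjI)
  \<comment> \<open>All five examples follow one pattern: the first components are the vectors of
    weight at most n div 2, and the fiber over r is a subgroup whose translate by r contains no
    other such vector.\<close>
  show "max_AP_free 3 (Z4 1) = 2"
    by (rule max_AP_free_Z4_witness[of 1 2 "[(0, [0, 1])]"])
      (simp_all add: valid_def config_bound1)
  show "max_AP_free 3 (Z4 2) = 6"
    by (rule max_AP_free_Z4_witness[of 2 6 "[(0, [0, 3]), (1, [0, 2]), (2, [0, 1])]"])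
      (simp_all add: valid_def config_bound2)
  show "max_AP_free 3 (Z4 3) = 16"
    by (rule max_AP_free_Z4_witness[of 3 16 "[(0, [0, 3, 5, 6]), (1, [0, 2, 4, 6]), (2, [0, 1, 4, 5]), (4, [0, 1, 2, 3])]"])
      (simp_all add: valid_def config_bound3)
  show "max_AP_free 3 (Z4 4) = 42"
    by (rule max_AP_free_Z4_witness[OF _ valid_witness4]) (simp_all add: witness4_def config_bound4)
  show "max_AP_free 3 (Z4 5) = 124"
    by (rule max_AP_free_Z4_witness[OF _ valid_witness5]) (simp_all add: witness5_def config_bound5)
qed

end
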